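(* Let $A\in\mathbb{H}^{n\times n}$ with $\operatorname{rk}A=s$, $k=\operatorname{Ind}A$, and $\operatorname{rk}(A^{k})=s_1\ge1$. Then the MPD inverse $X=(x_{ij})$ of $A$ has, for all $i,j\in\{1,\dots,n\}$, the following determinantal representations. (i) If $A$ is arbitrary, then $$x_{ij}=\frac{\sum_{\beta\in J_{s,n}\{i\}}\operatorname{cdet}_{i}\left((A^{*}A)_{.i}(\tilde v_{.j})\right)_{\beta}^{\beta}}{\left(\sum_{\beta\in J_{s,n}}\left|A^{*}A\right|_{\beta}^{\beta}\right)\left(\sum_{\beta\in J_{s_1,n}}\left|(A^{2k+1})^{*}A^{2k+1}\right|_{\beta}^{\beta}\right)},$$ where $\tilde v_{.j}$ is the $j$th column of $\tilde V:=A^{*}A^{2}V$, and $V=(v_{fj})\in\mathbb{H}^{n\times n}$ is the matrix with $$v_{fj}=\sum_{\beta\in J_{s_1,n}\{f\}}\operatorname{cdet}_{f}\left(\left((A^{2k+1})^{*}A^{2k+1}\right)_{.f}(\hat a_{.j})\right)_{\beta}^{\beta},$$ where $\hat a_{.j}$ is the $j$th column of $\hat A=(A^{2k+1})^{*}A$. (ii) If $A$ is Hermitian, then $$x_{ij}=\frac{\sum_{\beta\in J_{s,n}\{i\}}\operatorname{cdet}_{i}\left((A^{2})_{.i}(v_{.j})\right)_{\beta}^{\beta}}{\sum_{\beta\in J_{s,n}}\left|A^{2}\right|_{\beta}^{\beta}\ \sum_{\beta\in J_{s_1,n}}\left|A^{k+1}\right|_{\beta}^{\beta}}=\frac{\sum_{\alpha\in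 I_{s_1,n}\{j\}}\operatorname{rdet}_{j}\left((A^{k+1})_{j.}(u_{i.})\right)_{\alpha}^{\alpha}}{\sum_{\alpha\in I_{s_1,n}}\left|A^{k+1}\right|_{\alpha}^{\alpha}\ \sum_{\alpha\in I_{s,n}}\left|A^{2}\right|_{\alpha}^{\alpha}},$$ where $$v_{.j}=\Big[\sum_{\alpha\in I_{s_1,n}\{j\}}\operatorname{rdet}_{j}\left((A^{k+1})_{j.}(a^{(k+2)}_{l.})\right)_{\alpha}^{\alpha}\Big]_{l=1,\dots,n}\in\mathbb{H}^{n\times 1},$$ $$u_{i.}=\Big[\sum_{\beta\in J_{s,n}\{i\}}\operatorname{cdet}_{i}\left((A^{2})_{.i}(a^{(k+2)}_{.f})\right)_{\beta}^{\beta}\Big]_{f=1,\dots,n}\in\mathbb{H}^{1\times n},$$ and $a^{(k+2)}_{l.}$, $a^{(k+2)}_{.f}$ are the $l$th row and the $f$th column of $A^{k+2}$.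
   Context: $\mathbb{H}$ is the skew field of real quaternions, $A^{*}$ is the conjugate transpose, $A$ is Hermitian if $A^*=A$, and $\operatorname{rk}A$ is the rank of $A$ (dimension of the right column space, equal to the dimension of the left row space). $\operatorname{Ind}A$ is the smallest nonnegative integer $k$ with $\operatorname{rk}A^{k+1}=\operatorname{rk}A^{k}$ (with $A^0$ the identity; $\operatorname{Ind}A=0$ iff $A$ is nonsingular). The Moore-Penrose inverse $A^{\dagger}$ is the unique $X$ with $AXA=A$, $XAX=X$, $(AX)^{*}=AX$, $(XA)^{*}=XA$. The Drazin inverse $A^{d}$ is the unique $X$ with $XAX=X$, $AX=XA$, $XA^{k+1}=A^{k}$, $k=\operatorname{Ind}A$. The MPD inverse of $A$ is the unique matrix $X$ with $XAX=X$, $AX=AA^{d}$, $XA^{k}=A^{\dagger}A^{k}$; it equals $A^{\dagger}AA^{d}$. Row and column determinants: let $M=(m_{pq})$ be a square quaternion matrix of size $N$ whose rows and columns are both labelled by a set $\alpha$ of $N$ integers, and let $i,j\in\alpha$. Then $$\operatorname{rdet}_iM=\sum_{\sigma}(-1)^{N-r}\left(m_{i\,i_{k_1}}m_{i_{k_1}i_{k_1+1}}\cdots m_{i_{k_1+l_1}i}\right)\cdots\left(m_{i_{k_r}i_{k_r+1}}\cdots m_{i_{k_r+l_r}i_{k_r}}\right),$$ the sum over all permutations $\sigma$ of $\alpha$, each written as a product of its $r$ disjoint cycles (fixed points included) $\sigma=(i\,i_{k_1}\dots i_{k_1+l_1})(i_{k_2}\dots i_{k_2+l_2})\cdots(i_{k_r}\dots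 i_{k_r+l_r})$, where the first cycle starts with $i$, every other cycle starts with its smallest element, and $i_{k_2}<\dots<i_{k_r}$; and $$\operatorname{cdet}_jM=\sum_{\tau}(-1)^{N-r}\left(m_{j_{k_r}j_{k_r+l_r}}\cdots m_{j_{k_r+1}j_{k_r}}\right)\cdots\left(m_{j\,j_{k_1+l_1}}\cdots m_{j_{k_1+1}j_{k_1}}m_{j_{k_1}j}\right),$$ the sum over all permutations $\tau=(j_{k_r+l_r}\dots j_{k_r+1}j_{k_r})\cdots(j_{k_2+l_2}\dots j_{k_2})(j_{k_1+l_1}\dots j_{k_1}j)$ of $\alpha$, where the rightmost cycle ends with $j$, every other cycle has its smallest element rightmost, and $j_{k_2}<\dots<j_{k_r}$. A fixed point $p$ contributes the factor $m_{pp}$. If $M$ is Hermitian, all $\operatorname{rdet}_iM$ and $\operatorname{cdet}_jM$ coincide and are real; the common value is $\det M$. Index sets and submatrices: for $1\le k\le n$, $I_{k,n}=J_{k,n}$ is the set of all $k$-element subsets of $\{1,\dots,n\}$, and $I_{k,n}\{j\}=J_{k,n}\{j\}$ is the collection of those containing $j$. $M_\alpha^\alpha$ is the principal submatrix with rows and columns indexed by $\alpha$ (labels kept); for Hermitian $M$, $|M|_\alpha^\alpha=\det(M_\alpha^\alpha)$. $M_{j.}(b)$ (resp. $M_{.i}(c)$) is $M$ with its $j$th row replaced by the row $b$ (resp. $i$th column replaced by the column $c$). $\operatorname{rdet}_j(M_{j.}(b))_\alpha^\alpha$ means $\operatorname{rdet}_j$ (along the row labelled $j$) of the principal submatrix $(M_{j.}(b))_\alpha^\alpha$;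 similarly $\operatorname{cdet}_i(M_{.i}(c))_\beta^\beta$.
   Formalization: In (i) the printed Â=(A^{2k+1})^*A and Ṽ=A^*A²V are replaced by Â=(A^{2k+1})^*A^k and Ṽ=A^*A^{k+1}V; the two agree for k=1, and the printed version fails otherwise (A=[2], k=0 gives 2 instead of 1/2). *)

theory Defs
  imports "HOL-Analysis.Analysis" "HOL-Combinatorics.Combinatorics"
begin

section \<open>The skew field of real quaternions\<close>

datatype quat = Quat (qre: real) (qi: real) (qj: real) (qk: real)

lemma quat_eq_iff: "x = y \<longleftrightarrow> qre x = qre y \<and> qi x = qi y \<and> qj x = qj y \<and> qk x = qk y"
  by (cases x; cases y) simp

instantiation quat :: "{zero, one, plus, minus, uminus, times, inverse, scaleR}"
begin

definition "0 = Quat 0 0 0 0"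
definition "1 = Quat 1 0 0 0"
definition "x + y = Quat (qre x + qre y) (qi x + qi y) (qj x + qj y) (qk x + qk y)"
definition "x - y = Quat (qre x - qre y) (qi x - qi y) (qj x - qj y) (qk x - qk y)"
definition "- x = Quat (- qre x) (- qi x) (- qj x) (- qk x)"
definition "x * y =
  Quat (qre x * qre y - qi x * qi y - qj x * qj y - qk x * qk y)
       (qre x * qi y + qi x * qre y + qj x * qk y - qk x * qj y)
       (qre x * qj y - qi x * qk y + qj x * qre y + qk x * qi y)
       (qre x * qk y + qi x * qj y - qj x * qi y + qk x * qre y)"
definition "c *\<^sub>R x = Quat (c * qre x) (c * qi x) (c * qj x) (c * qk x)"
definition "inverse x =
  (let N = (qre x)\<^sup>2 + (qi x)\<^sup>2 + (qj x)\<^sup>2 + (qk x)\<^sup>2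
   in Quat (qre x / N) (- qi x / N) (- qj x / N) (- qk x / N))"
definition "x div y = x * inverse (y :: quat)"

instance ..

end

lemmas quat_ops_def =
  zero_quat_def one_quat_def plus_quat_def minus_quat_def uminus_quat_def
  times_quat_def scaleR_quat_def

lemma quat_normsq_pos:
  assumes "x \<noteq> 0"
  shows "(qre x)\<^sup>2 + (qi x)\<^sup>2 + (qj x)\<^sup>2 + (qk x)\<^sup>2 > 0"
proof -
  have "qre x \<noteq> 0 \<or> qi x \<noteq> 0 \<or> qj x \<noteq> 0 \<or> qk x \<noteq> 0"
    using assms by (auto simp: quat_eq_iff zero_quat_def)
  then show ?thesis
    by (auto simp: add_pos_nonneg add_nonneg_pos)
qed

instance quat :: real_algebra_1
  by standard (simp_all add: quat_eq_iff quat_ops_def algebra_simps)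

instance quat :: real_div_algebra
proof
  fix x y :: quat
  show "x div y = x * inverse y" by (simp add: divide_quat_def)
  show "inverse (0 :: quat) = 0" by (simp add: inverse_quat_def zero_quat_def)
  assume x: "x \<noteq> 0"
  define N where "N = (qre x)\<^sup>2 + (qi x)\<^sup>2 + (qj x)\<^sup>2 + (qk x)\<^sup>2"
  have "N > 0" unfolding N_def by (rule quat_normsq_pos[OF x])
  then have N: "N \<noteq> 0" by simp
  have i: "inverse x = Quat (qre x / N) (- qi x / N) (- qj x / N) (- qk x / N)"
    by (simp add: inverse_quat_def N_def Let_def)
  have "(qre x * qre x + qi x * qi x + qj x * qj x + qk x * qk x) / N = 1"
    using N by (simp add: N_def power2_eq_square)
  then show "inverse x * x = 1" "x * inverse x = 1"
    unfolding i by (simp_all add: quat_eq_iff quat_ops_def add_divide_distrib mult.commute)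
qed

definition qcnj :: "quat \<Rightarrow> quat" where
  "qcnj x = Quat (qre x) (- qi x) (- qj x) (- qk x)"

section \<open>Quaternion matrices\<close>

text \<open>
  The row and column labels 1, ..., n are the elements of a finite type 'n with n elements, which is
  in addition linearly ordered where labels have to be compared.
\<close>

type_synonym 'n qvec = "quat^'n"
type_synonym 'n qmat = "quat^'n^'n"

definition qadj :: "quat^'n^'m \<Rightarrow> quat^'m^'n" where
  "qadj A = (\<chi> i j. qcnj (A $ j $ i))"

definition qhermitian :: "'n::finite qmat \<Rightarrow> bool" where
  "qhermitian A \<longleftrightarrow> qadj A = A"

text \<open>The library's \<open>^\<close> on vectors and matrices acts entrywise, so matrix powers are defined here.\<close>

primrec mpow :: "'n::finite qmat \<Rightarrow> nat \<Rightarrow> 'n qmat" where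
  "mpow A 0 = mat 1"
| "mpow A (Suc m) = A ** mpow A m"

text \<open>
  The library's vector spaces are over commutative fields; the following are the corresponding
  notions for right vector spaces of quaternion column vectors.
\<close>

definition right_scale :: "quat^'m \<Rightarrow> quat \<Rightarrow> quat^'m" where
  "right_scale v c = (\<chi> p. v $ p * c)"

definition right_span :: "(quat^'m) set \<Rightarrow> (quat^'m) set" where
  "right_span B = {x. \<exists>F c. finite F \<and> F \<subseteq> B \<and> x = (\<Sum>v\<in>F. right_scale v (c v))}"

definition right_independent :: "(quat^'m) set \<Rightarrow> bool" where
  "right_independent B \<longleftrightarrow>
     (\<forall>F c. finite F \<and> F \<subseteq> B \<and> (\<Sum>v\<in>F. right_scale v (c v)) = 0 \<longrightarrow> (\<forall>v\<in>F. c v = 0))"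

definition right_dim :: "(quat^'m) set \<Rightarrow> nat" where
  "right_dim W = card (SOME B. right_independent B \<and> right_span B = W)"

definition qrank :: "quat^'n^'m \<Rightarrow> nat" where
  "qrank A = right_dim (right_span (columns A))"

definition qindex :: "'n::finite qmat \<Rightarrow> nat" where
  "qindex A = (LEAST m. qrank (mpow A (m + 1)) = qrank (mpow A m))"

section \<open>Generalized inverses\<close>

definition mp_inverse :: "quat^'n^'m \<Rightarrow> quat^'m^'n" where
  "mp_inverse A = (THE X. A ** X ** A = A \<and> X ** A ** X = X \<and>
     qadj (A ** X) = A ** X \<and> qadj (X ** A) = X ** A)"

definition drazin_inverse :: "'n::finite qmat \<Rightarrow> 'n qmat" where
  "drazin_inverse A = (THE X. X ** A ** X = X \<and> A ** X = X ** A \<and>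
     X ** mpow A (qindex A + 1) = mpow A (qindex A))"

definition mpd_inverse :: "'n::finite qmat \<Rightarrow> 'n qmat" where
  "mpd_inverse A = (THE X. X ** A ** X = X \<and> A ** X = A ** drazin_inverse A \<and>
     X ** mpow A (qindex A) = mp_inverse A ** mpow A (qindex A))"

section \<open>Row and column determinants\<close>

text \<open>
  The determinants below take the label set \<open>\<alpha>\<close> as an argument and read only the entries of \<open>M\<close> with
  both labels in \<open>\<alpha>\<close>; thus \<open>rdet \<alpha> i M\<close> is the row determinant along the row labelled \<open>i\<close> of
  the principal submatrix of \<open>M\<close> on \<open>\<alpha>\<close>, with labels kept.

  The factor contributed by the cycle of \<open>\<sigma>\<close> through \<open>p\<close> is
  \<open>m(p, \<sigma> p) m(\<sigma> p, \<sigma>\<^sup>2 p) \<cdots> m(\<sigma>\<^sup>-\<^sup>1 p, p)\<close>. In a column determinant the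
  cycle is written with \<open>p\<close> rightmost, \<open>(\<sigma> p, \<sigma>\<^sup>2 p, \<dots>, \<sigma>\<^sup>-\<^sup>1 p, p)\<close>, and its factor is
  this same product; only the order in which the cycles are multiplied differs.
\<close>

definition cycle_prod :: "'n::finite qmat \<Rightarrow> ('n \<Rightarrow> 'n) \<Rightarrow> 'n \<Rightarrow> quat" where
  "cycle_prod M \<sigma> p =
     prod_list (map (\<lambda>t. M $ ((\<sigma> ^^ t) p) $ ((\<sigma> ^^ Suc t) p)) [0..<card (orbit \<sigma> p)])"

definition cycle_sign :: "'n set \<Rightarrow> ('n \<Rightarrow> 'n) \<Rightarrow> quat" where
  "cycle_sign \<alpha> \<sigma> = (- 1) ^ (card \<alpha> - card (orbit \<sigma> ` \<alpha>))"

text \<open>The least elements, in increasing order, of the cycles of \<open>\<sigma>\<close> on \<open>\<alpha>\<close> not containing \<open>i\<close>.\<close>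

definition cycle_mins :: "'n::{finite,linorder} set \<Rightarrow> 'n \<Rightarrow> ('n \<Rightarrow> 'n) \<Rightarrow> 'n list" where
  "cycle_mins \<alpha> i \<sigma> = sorted_list_of_set {p \<in> \<alpha>. i \<notin> orbit \<sigma> p \<and> p = Min (orbit \<sigma> p)}"

definition rdet :: "'n::{finite,linorder} set \<Rightarrow> 'n \<Rightarrow> 'n qmat \<Rightarrow> quat" where
  "rdet \<alpha> i M = (\<Sum>\<sigma> | \<sigma> permutes \<alpha>. cycle_sign \<alpha> \<sigma> *
     (cycle_prod M \<sigma> i * prod_list (map (cycle_prod M \<sigma>) (cycle_mins \<alpha> i \<sigma>))))"

definition cdet :: "'n::{finite,linorder} set \<Rightarrow> 'n \<Rightarrow> 'n qmat \<Rightarrow> quat" where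
  "cdet \<alpha> j M = (\<Sum>\<tau> | \<tau> permutes \<alpha>. cycle_sign \<alpha> \<tau> *
     (prod_list (map (cycle_prod M \<tau>) (rev (cycle_mins \<alpha> j \<tau>))) * cycle_prod M \<tau> j))"

text \<open>
  The common real value of all row and column determinants of a Hermitian principal submatrix on a
  nonempty label set.
\<close>

definition hdet :: "'n::{finite,linorder} set \<Rightarrow> 'n qmat \<Rightarrow> real" where
  "hdet \<alpha> M = (THE d. \<forall>i\<in>\<alpha>. rdet \<alpha> i M = of_real d \<and> cdet \<alpha> i M = of_real d)"

definition repl_row :: "quat^'n^'m \<Rightarrow> 'm \<Rightarrow> quat^'n \<Rightarrow> quat^'n^'m" where
  "repl_row M j b = (\<chi> p q. if p = j then b $ q else M $ p $ q)"

definition repl_col :: "quat^'n^'m \<Rightarrow> 'n \<Rightarrow> quat^'m \<Rightarrow> quat^'n^'m" where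
  "repl_col M i c = (\<chi> p q. if q = i then c $ p else M $ p $ q)"

definition ksets :: "nat \<Rightarrow> 'n::finite set set" where
  "ksets m = {\<beta>. card \<beta> = m}"

definition ksets_at :: "nat \<Rightarrow> 'n::finite \<Rightarrow> 'n set set" where
  "ksets_at m i = {\<beta>. card \<beta> = m \<and> i \<in> \<beta>}"

section \<open>The matrices and vectors entering the determinantal representations\<close>

text \<open>
  For an arbitrary matrix the source prints \<open>(A\<^sup>2\<^sup>k\<^sup>+\<^sup>1)\<^sup>* A\<close> and \<open>A\<^sup>* A\<^sup>2 V\<close> here. That is not
  correct in general unless \<open>k = 1\<close>: for the 1 by 1 matrix 2, where \<open>k = 0\<close>, it would make the MPD inverse 2 instead
  of 1/2. The powers \<open>A\<^sup>k\<close> and \<open>A\<^sup>k\<^sup>+\<^sup>1\<close> below agree with the printed ones for \<open>k = 1\<close> and come from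
  the identity \<open>A\<^sup>d = A\<^sup>k (A\<^sup>2\<^sup>k\<^sup>+\<^sup>1)\<^sup>\<dagger> A\<^sup>k\<close>.
\<close>

definition A_hat :: "'n::finite qmat \<Rightarrow> 'n qmat" where
  "A_hat A = qadj (mpow A (2 * qindex A + 1)) ** mpow A (qindex A)"

definition V_mat :: "'n::{finite,linorder} qmat \<Rightarrow> 'n qmat" where
  "V_mat A = (let k = qindex A; T = mpow A (2 * k + 1) in
     \<chi> f j. \<Sum>\<beta>\<in>ksets_at (qrank (mpow A k)) f.
       cdet \<beta> f (repl_col (qadj T ** T) f (column j (A_hat A))))"

definition V_tilde :: "'n::{finite,linorder} qmat \<Rightarrow> 'n qmat" where
  "V_tilde A = qadj A ** mpow A (qindex A + 1) ** V_mat A"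

text \<open>The column \<open>v\<^sub>.\<^sub>j\<close> and the row \<open>u\<^sub>i\<^sub>.\<close> of the Hermitian case.\<close>

definition v_col :: "'n::{finite,linorder} qmat \<Rightarrow> 'n \<Rightarrow> 'n qvec" where
  "v_col A j = (let k = qindex A in
     \<chi> l. \<Sum>\<alpha>\<in>ksets_at (qrank (mpow A k)) j.
       rdet \<alpha> j (repl_row (mpow A (k + 1)) j (row l (mpow A (k + 2)))))"

definition u_row :: "'n::{finite,linorder} qmat \<Rightarrow> 'n \<Rightarrow> 'n qvec" where
  "u_row A i = (let k = qindex A in
     \<chi> f. \<Sum>\<beta>\<in>ksets_at (qrank A) i.
       cdet \<beta> i (repl_col (mpow A 2) i (column f (mpow A (k + 2)))))"

end

theory Submission
  imports Defs
begin

text \<open>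
  For Hermitian \<open>H\<close>, reversing a cycle conjugates its factor, so only the real parts of the cycle
  factors survive in \<open>cdet\<close> and \<open>rdet\<close>, and these determinants are real and independent of the
  row or column. The matrix \<open>coadj m H\<close> collecting the numerators over the label sets of size \<open>m\<close>
  then satisfies the recursion \<open>coadj (m+1) H + coadj m H ** H = d\<^sub>m\<close>, where \<open>d\<^sub>m\<close> is the sum of
  the principal minors of size \<open>m\<close>. If \<open>r\<close> is the largest index with \<open>d\<^sub>r \<noteq> 0\<close>, the recursion
  read backwards from \<open>m = n\<close> gives \<open>coadj (r+1) H ** H = 0\<close>; hence \<open>coadj r H ** H / d\<^sub>r\<close> is the
  projection onto the column space of \<open>H\<close>, and since the real trace of an idempotent is its
  rank, \<open>r\<close> is the rank of \<open>H\<close>. Applied to \<open>A\<^sup>*A\<close> this yields \<open>A\<^sup>\<dagger> = coadj s (A\<^sup>*A) ** A\<^sup>* / d\<^sub>s\<close>, and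
  the theorem follows from \<open>X = A\<^sup>\<dagger> A A\<^sup>d\<close> and \<open>A\<^sup>d = A\<^sup>k (A\<^sup>2\<^sup>k\<^sup>+\<^sup>1)\<^sup>\<dagger> A\<^sup>k\<close>.
\<close>

section \<open>Quaternions and cycles of permutations\<close>

text \<open>Row and column determinants are not multiplicative, so neither the Cauchy-Binet formula
  nor the classical link between rank and minors is at hand. Two cofactor facts about a Hermitian
  \<open>H\<close> take their place: column \<open>i\<close> of \<open>H\<close> put into position
  \<open>i\<close> gives the principal minor, and another column whose label lies in the same set
  gives zero. Both come from involutions on permutations. They close up into a recursion only
  because the sums run over all label sets of one size: deleting a label from a set leads to the
  numerators of the next smaller size. That the denominators do not vanish is obtained without
  eigenvalues. A largest index with nonzero \<open>minor_sum\<close> exists because the sum for size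
  0 is 1, and only afterwards is this index recognized as the rank.\<close>

lemma qcnj_simps [simp]:
  "qcnj (x + y) = qcnj x + qcnj y" "qcnj (x - y) = qcnj x - qcnj y" "qcnj (- x) = - qcnj x"
  "qcnj 0 = 0" "qcnj 1 = 1" "qcnj (qcnj x) = x" "qcnj (r *\<^sub>R x) = r *\<^sub>R qcnj x"
  "qcnj (x * y) = qcnj y * qcnj x"
  by (simp_all add: qcnj_def quat_eq_iff quat_ops_def algebra_simps)

lemma qcnj_of_real [simp]: "qcnj (of_real r) = of_real r"
  by (simp add: of_real_def)

lemma qcnj_sum: "qcnj (sum f S) = (\<Sum>x\<in>S. qcnj (f x))"
  by (induction S rule: infinite_finite_induct) simp_all

lemma qcnj_prod_list: "qcnj (prod_list xs) = prod_list (map qcnj (rev xs))"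
  by (induction xs) simp_all

lemma qre_simps [simp]:
  "qre (x + y) = qre x + qre y" "qre (x - y) = qre x - qre y" "qre (- x) = - qre x"
  "qre 0 = 0" "qre 1 = 1" "qre (r *\<^sub>R x) = r * qre x" "qre (qcnj x) = qre x"
  by (simp_all add: qcnj_def quat_ops_def)

lemma qre_of_real [simp]: "qre (of_real r) = r"
  by (simp add: of_real_def)

lemma qre_sum: "qre (sum f S) = (\<Sum>x\<in>S. qre (f x))"
  by (induction S rule: infinite_finite_induct) simp_all

text \<open>All that remains of commutativity. It makes the real part of a cycle factor independent
  of the starting label and the real trace invariant under exchanging two factors.\<close>

lemma qre_mult_commute: "qre (x * y) = qre (y * x)"
  by (simp add: quat_ops_def)

lemma add_qcnj: "x + qcnj x = 2 *\<^sub>R of_real (qre x)"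
  by (simp add: of_real_def qcnj_def quat_eq_iff quat_ops_def)

lemma qre_mult_qcnj: "qre (x * qcnj x) = (qre x)\<^sup>2 + (qi x)\<^sup>2 + (qj x)\<^sup>2 + (qk x)\<^sup>2"
  by (simp add: qcnj_def quat_ops_def power2_eq_square)

lemma qre_mult_qcnj_nonneg: "qre (x * qcnj x) \<ge> 0"
  by (simp add: qre_mult_qcnj)

lemma qre_mult_qcnj_eq_0_iff: "qre (x * qcnj x) = 0 \<longleftrightarrow> x = 0"
proof
  assume "qre (x * qcnj x) = 0"
  then show "x = 0" using quat_normsq_pos[of x] by (auto simp: qre_mult_qcnj)
qed simp

section \<open>Orbits and products along cycles\<close>

lemma permutation_if_permutes:
  fixes \<sigma> :: "'a::finite \<Rightarrow> 'a"
  shows "\<sigma> permutes \<alpha> \<Longrightarrow> permutation \<sigma>"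
  using finite permutation_permutes by blast

text \<open>Links the length \<open>card (orbit \<sigma> x)\<close> used in
  \<open>cycle_prod\<close> with the first return time: the powers before the return enumerate the
  orbit without repetition.\<close>

lemma
  assumes "permutation \<sigma>"
  shows funpow_card_orbit: "(\<sigma> ^^ card (orbit \<sigma> x)) x = x"
    and orbit_eq_image: "orbit \<sigma> x = (\<lambda>t. (\<sigma> ^^ t) x) ` {..<card (orbit \<sigma> x)}"
    and inj_on_funpow_orbit: "inj_on (\<lambda>t. (\<sigma> ^^ t) x) {..<card (orbit \<sigma> x)}"
    and card_orbit_pos: "card (orbit \<sigma> x) > 0"
proof -
  have x: "x \<in> orbit \<sigma> x" by (rule permutation_self_in_orbit[OF assms])
  let ?n = "funpow_dist1 \<sigma> x x"
  have o: "orbit \<sigma> x = (\<lambda>t. (\<sigma> ^^ t) x) ` {0..<?n}" by (rule orbit_conv_funpow_dist1[OF x])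
  have i: "inj_on (\<lambda>t. (\<sigma> ^^ t) x) {0..<?n}" by (rule inj_on_funpow_dist1[OF x])
  have c: "card (orbit \<sigma> x) = ?n" by (subst o) (simp add: card_image[OF i])
  show "(\<sigma> ^^ card (orbit \<sigma> x)) x = x" unfolding c by (rule funpow_dist1_prop[OF x])
  show "orbit \<sigma> x = (\<lambda>t. (\<sigma> ^^ t) x) ` {..<card (orbit \<sigma> x)}" using o c by (simp add: lessThan_atLeast0)
  show "inj_on (\<lambda>t. (\<sigma> ^^ t) x) {..<card (orbit \<sigma> x)}" using i c by (simp add: lessThan_atLeast0)
  show "card (orbit \<sigma> x) > 0" using c by simp
qed

lemma funpow_card_orbit_minus_1:
  assumes "permutation \<sigma>"
  shows "(\<sigma> ^^ (card (orbit \<sigma> x) - 1)) x = inv \<sigma> x"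
proof -
  have "\<sigma> ((\<sigma> ^^ (card (orbit \<sigma> x) - 1)) x) = (\<sigma> ^^ Suc (card (orbit \<sigma> x) - 1)) x" by simp
  also have "\<dots> = x" using funpow_card_orbit[OF assms, of x] card_orbit_pos[OF assms, of x] by simp
  finally show ?thesis using permutation_bijective[OF assms] by (metis bij_inv_eq_iff)
qed

lemma funpow_cong_orbit:
  assumes "permutation f" and "\<And>y. y \<in> orbit f x \<Longrightarrow> g y = f y"
  shows "(g ^^ t) x = (f ^^ t) x"
proof (induction t)
  case (Suc t)
  have "(f ^^ t) x \<in> orbit f x"
    using permutation_self_in_orbit[OF assms(1)] by (rule funpow_in_orbit)
  with Suc assms(2) show ?case by simp
qed simp

lemma orbit_cong_permutation:
  assumes "permutation f" and "\<And>y. y \<in> orbit f x \<Longrightarrow> g y = f y"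
  shows "orbit g x = orbit f x"
  using permutation_self_in_orbit[OF assms(1)] assms(2) by (rule orbit_cong)

lemma orbit_eq_orbit:
  assumes "permutation f" and "y \<in> orbit f x"
  shows "orbit f y = orbit f x"
  using orbit_cyclic_eq3[OF cyclic_on_orbit'[OF assms(1)] assms(2)] .

lemma mem_orbit_commute:
  assumes "permutation f"
  shows "y \<in> orbit f x \<longleftrightarrow> x \<in> orbit f y"
  using orbit_eq_orbit[OF assms] permutation_self_in_orbit[OF assms] by metis

text \<open>\<open>cycle_prod\<close> with a free length, so that a cycle can be cut into arcs and
  arcs can be joined.\<close>

definition path_prod :: "'n::finite qmat \<Rightarrow> ('n \<Rightarrow> 'n) \<Rightarrow> 'n \<Rightarrow> nat \<Rightarrow> quat" where
  "path_prod M \<sigma> x m = prod_list (map (\<lambda>t. M $ ((\<sigma> ^^ t) x) $ ((\<sigma> ^^ Suc t) x)) [0..<m])"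

lemma path_prod_0 [simp]: "path_prod M \<sigma> x 0 = 1"
  by (simp add: path_prod_def)

lemma path_prod_Suc: "path_prod M \<sigma> x (Suc m) = path_prod M \<sigma> x m * M $ ((\<sigma> ^^ m) x) $ ((\<sigma> ^^ Suc m) x)"
  by (simp add: path_prod_def)

lemma path_prod_add: "path_prod M \<sigma> x (m + l) = path_prod M \<sigma> x m * path_prod M \<sigma> ((\<sigma> ^^ m) x) l"
proof (induction l)
  case (Suc l)
  have "(\<sigma> ^^ (m + l)) x = (\<sigma> ^^ l) ((\<sigma> ^^ m) x)" by (simp add: add.commute[of m l] funpow_add)
  with Suc show ?case by (simp add: path_prod_Suc mult.assoc)
qed simp

lemma path_prod_cong:
  assumes "\<And>t. t \<le> m \<Longrightarrow> (\<sigma> ^^ t) x = (\<tau> ^^ t) y"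
  shows "path_prod M \<sigma> x m = path_prod M \<tau> y m"
  unfolding path_prod_def
  by (rule arg_cong[where f = prod_list], rule map_cong[OF refl])
     (use assms in \<open>metis Suc_leI atLeastLessThan_iff less_imp_le_nat set_upt\<close>)

lemma cycle_prod_eq_path_prod: "cycle_prod M \<sigma> x = path_prod M \<sigma> x (card (orbit \<sigma> x))"
  by (simp add: cycle_prod_def path_prod_def)

text \<open>A cycle without its closing factor \<open>M $ inv \<sigma> x $ x\<close>. Only that
  factor reads column \<open>x\<close> of \<open>M\<close>, so replacing this column leaves the open
  product untouched.\<close>

definition open_prod :: "'n::finite qmat \<Rightarrow> ('n \<Rightarrow> 'n) \<Rightarrow> 'n \<Rightarrow> quat" where
  "open_prod M \<sigma> x = path_prod M \<sigma> x (card (orbit \<sigma> x) - 1)"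

lemma cycle_prod_eq_open_prod:
  assumes "permutation \<sigma>"
  shows "cycle_prod M \<sigma> x = open_prod M \<sigma> x * M $ (inv \<sigma> x) $ x"
proof -
  obtain m where m: "card (orbit \<sigma> x) = Suc m"
    using card_orbit_pos[OF assms, of x] gr0_implies_Suc by blast
  show ?thesis
    using funpow_card_orbit[OF assms, of x] funpow_card_orbit_minus_1[OF assms, of x] m
    by (simp add: cycle_prod_eq_path_prod open_prod_def path_prod_Suc)
qed

lemma cycle_prod_cong:
  assumes "permutation f" and "\<And>y. y \<in> orbit f x \<Longrightarrow> g y = f y"
  shows "cycle_prod M g x = cycle_prod M f x"
proof -
  have "orbit g x = orbit f x" "\<And>t. (g ^^ t) x = (f ^^ t) x"
    by (rule orbit_cong_permutation[OF assms(1)], erule assms(2))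
       (rule funpow_cong_orbit[OF assms(1)], erule assms(2))
  then show ?thesis by (simp only: cycle_prod_def)
qed

text \<open>Moving the starting label one step takes the first factor to the end of the product,
  which the real part does not notice.\<close>

lemma qre_cycle_prod_step:
  assumes "permutation \<sigma>"
  shows "qre (cycle_prod M \<sigma> (\<sigma> x)) = qre (cycle_prod M \<sigma> x)"
proof -
  obtain m where m: "card (orbit \<sigma> x) = Suc m"
    using card_orbit_pos[OF assms, of x] gr0_implies_Suc by blast
  have o: "orbit \<sigma> (\<sigma> x) = orbit \<sigma> x" by (rule permutation_orbit_step[OF assms])
  have e: "(\<sigma> ^^ m) (\<sigma> x) = x" using funpow_card_orbit[OF assms, of x] m by (simp add: funpow_swap1)
  have "cycle_prod M \<sigma> x = M $ x $ (\<sigma> x) * path_prod M \<sigma> (\<sigma> x) m"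
    using path_prod_add[of M \<sigma> x 1 m] by (simp add: cycle_prod_eq_path_prod m path_prod_Suc)
  moreover have "cycle_prod M \<sigma> (\<sigma> x) = path_prod M \<sigma> (\<sigma> x) m * M $ x $ (\<sigma> x)"
    by (simp add: cycle_prod_eq_path_prod o m path_prod_Suc e)
  ultimately show ?thesis by (simp add: qre_mult_commute)
qed

lemma qre_cycle_prod_orbit:
  assumes "permutation \<sigma>" and "y \<in> orbit \<sigma> x"
  shows "qre (cycle_prod M \<sigma> y) = qre (cycle_prod M \<sigma> x)"
  using assms(2) by induction (simp_all add: qre_cycle_prod_step[OF assms(1)])

text \<open>Running a cycle backwards reverses the product and transposes each entry, as conjugating
  the product for the adjoint does; for Hermitian \<open>M\<close> the two directions are therefore
  conjugate.\<close>

lemma cycle_prod_inv: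
  assumes "permutation \<sigma>"
  shows "cycle_prod M (inv \<sigma>) x = qcnj (cycle_prod (qadj M) \<sigma> x)"
proof -
  define c where "c = card (orbit \<sigma> x)"
  have inv_pow: "(inv \<sigma> ^^ t) x = (\<sigma> ^^ (c - t)) x" if "t \<le> c" for t
    using that
  proof (induction t)
    case 0 then show ?case using funpow_card_orbit[OF assms, of x] by (simp add: c_def)
  next
    case (Suc t)
    have "(\<sigma> ^^ (c - t)) x = \<sigma> ((\<sigma> ^^ (c - Suc t)) x)"
      using Suc.prems by (metis Suc_diff_le comp_apply diff_Suc_Suc funpow.simps(2))
    then show ?case using Suc permutation_bijective[OF assms] by (simp add: bij_is_inj)
  qed
  have "cycle_prod M (inv \<sigma>) x = prod_list (map (\<lambda>t. M $ ((\<sigma> ^^ (c - t)) x) $ ((\<sigma> ^^ (c - Suc t)) x)) [0..<c])"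
    unfolding cycle_prod_def orbit_inv_eq[OF assms] c_def[symmetric]
    by (rule arg_cong[where f = prod_list], rule map_cong[OF refl])
       (simp only: inv_pow set_upt atLeastLessThan_iff Suc_leI less_imp_le_nat)
  also have "map (\<lambda>t. M $ ((\<sigma> ^^ (c - t)) x) $ ((\<sigma> ^^ (c - Suc t)) x)) [0..<c] =
      rev (map (\<lambda>t. M $ ((\<sigma> ^^ Suc t) x) $ ((\<sigma> ^^ t) x)) [0..<c])"
    by (rule nth_equalityI) (auto simp: rev_nth Suc_diff_Suc simp del: funpow.simps)
  also have "prod_list \<dots> = qcnj (cycle_prod (qadj M) \<sigma> x)"
    unfolding cycle_prod_def c_def qcnj_prod_list
    by (simp add: rev_map o_def qadj_def)
  finally show ?thesis .
qed

text \<open>Inverts one cycle and keeps every orbit as a set, hence also the sign, the least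
  elements and the factors of the other cycles.\<close>

definition cycle_reverse :: "'n::finite \<Rightarrow> ('n \<Rightarrow> 'n) \<Rightarrow> 'n \<Rightarrow> 'n" where
  "cycle_reverse p \<sigma> x = (if x \<in> orbit \<sigma> p then inv \<sigma> x else \<sigma> x)"

lemma orbit_invariant:
  assumes "permutation \<sigma>"
  shows "\<sigma> x \<in> orbit \<sigma> p \<longleftrightarrow> x \<in> orbit \<sigma> p" "inv \<sigma> x \<in> orbit \<sigma> p \<longleftrightarrow> x \<in> orbit \<sigma> p"
proof -
  have 1: "\<sigma> x \<in> orbit \<sigma> p \<longleftrightarrow> x \<in> orbit \<sigma> p" for x
    using assms mem_orbit_commute permutation_orbit_step by metis
  show "\<sigma> x \<in> orbit \<sigma> p \<longleftrightarrow> x \<in> orbit \<sigma> p" by (rule 1)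
  show "inv \<sigma> x \<in> orbit \<sigma> p \<longleftrightarrow> x \<in> orbit \<sigma> p"
    using 1[of "inv \<sigma> x"] permutation_bijective[OF assms] by (simp add: bij_is_surj surj_f_inv_f)
qed

lemma permutes_cycle_reverse:
  fixes \<sigma> :: "'n::finite \<Rightarrow> 'n"
  assumes "\<sigma> permutes \<alpha>"
  shows "cycle_reverse p \<sigma> permutes \<alpha>"
proof -
  have perm: "permutation \<sigma>" by (rule permutation_if_permutes[OF assms])
  \<comment> \<open>The inverse map: forward on the reversed orbit, backward elsewhere. It works
    since \<open>orbit \<sigma> p\<close> is invariant under \<open>\<sigma>\<close> and
    \<open>inv \<sigma>\<close>.\<close>
  let ?g = "\<lambda>x. if x \<in> orbit \<sigma> p then \<sigma> x else inv \<sigma> x"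
  have "bij (cycle_reverse p \<sigma>)"
    by (rule o_bij[where g = ?g])
       (auto simp: fun_eq_iff cycle_reverse_def orbit_invariant[OF perm] permutes_inverses[OF assms])
  moreover have "cycle_reverse p \<sigma> x = x" if "x \<notin> \<alpha>" for x
    using that assms permutes_inv[OF assms] by (auto simp: cycle_reverse_def permutes_def)
  ultimately show ?thesis unfolding permutes_def by (simp add: bij_iff)
qed

lemma orbit_cycle_reverse:
  assumes "permutation \<sigma>"
  shows "orbit (cycle_reverse p \<sigma>) x = orbit \<sigma> x"
proof (cases "x \<in> orbit \<sigma> p")
  case True
  have "orbit (cycle_reverse p \<sigma>) x = orbit (inv \<sigma>) x"
    by (rule orbit_cong_permutation)
       (use True in \<open>simp_all add: permutation_inverse assms cycle_reverse_def orbit_inv_eq orbit_eq_orbit[OF assms True]\<close>)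
  then show ?thesis by (simp add: orbit_inv_eq assms)
next
  case False
  then have "y \<notin> orbit \<sigma> p" if "y \<in> orbit \<sigma> x" for y
    using that assms by (metis mem_orbit_commute orbit_eq_orbit)
  then show ?thesis by (intro orbit_cong_permutation) (auto simp: assms cycle_reverse_def)
qed

lemma cycle_prod_cycle_reverse:
  assumes "permutation \<sigma>"
  shows "cycle_prod M (cycle_reverse p \<sigma>) x =
    (if x \<in> orbit \<sigma> p then qcnj (cycle_prod (qadj M) \<sigma> x) else cycle_prod M \<sigma> x)"
proof (cases "x \<in> orbit \<sigma> p")
  case True
  have "cycle_prod M (cycle_reverse p \<sigma>) x = cycle_prod M (inv \<sigma>) x"
    by (rule cycle_prod_cong)
       (use True in \<open>simp_all add: permutation_inverse assms cycle_reverse_def orbit_inv_eq orbit_eq_orbit[OF assms True]\<close>)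
  then show ?thesis by (simp add: True cycle_prod_inv assms)
next
  case False
  then have "y \<notin> orbit \<sigma> p" if "y \<in> orbit \<sigma> x" for y
    using that assms by (metis mem_orbit_commute orbit_eq_orbit)
  then show ?thesis using False by (simp, intro cycle_prod_cong) (auto simp: assms cycle_reverse_def)
qed

lemma permutation_cycle_reverse:
  fixes \<sigma> :: "'n::finite \<Rightarrow> 'n"
  shows "permutation \<sigma> \<Longrightarrow> permutation (cycle_reverse p \<sigma>)"
  using permutes_cycle_reverse by (metis permutation_permutes)

lemma cycle_reverse_cycle_reverse:
  fixes \<sigma> :: "'n::finite \<Rightarrow> 'n"
  assumes "permutation \<sigma>"
  shows "cycle_reverse p (cycle_reverse p \<sigma>) = \<sigma>"
proof
  fix x
  have b: "bij \<sigma>" by (rule permutation_bijective[OF assms])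
  have "inv (cycle_reverse p \<sigma>) x = \<sigma> x" if "x \<in> orbit \<sigma> p"
  proof (rule inv_f_eq)
    show "inj (cycle_reverse p \<sigma>)"
      using permutation_bijective[OF permutation_cycle_reverse[OF assms]] by (rule bij_is_inj)
    show "cycle_reverse p \<sigma> (\<sigma> x) = x"
      using that b by (simp add: cycle_reverse_def orbit_invariant[OF assms] bij_is_inj)
  qed
  then show "cycle_reverse p (cycle_reverse p \<sigma>) x = \<sigma> x"
    unfolding cycle_reverse_def[of p "cycle_reverse p \<sigma>"] orbit_cycle_reverse[OF assms]
    by (auto simp: cycle_reverse_def)
qed

section \<open>Determinants of Hermitian matrices\<close>

text \<open>The sign as a real number: real scalars commute with every quaternion and can be
  collected in front by \<open>*\<^sub>R\<close>.\<close>

definition csgn :: "'n::finite set \<Rightarrow> ('n \<Rightarrow> 'n) \<Rightarrow> real" where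
  "csgn \<alpha> \<sigma> = (- 1) ^ (card \<alpha> - card (orbit \<sigma> ` \<alpha>))"

lemma cycle_sign_eq: "cycle_sign \<alpha> \<sigma> = of_real (csgn \<alpha> \<sigma>)"
  by (simp add: cycle_sign_def csgn_def)

lemma csgn_cong: "(\<And>x. orbit \<tau> x = orbit \<sigma> x) \<Longrightarrow> csgn \<alpha> \<tau> = csgn \<alpha> \<sigma>"
  by (simp add: csgn_def)

lemma cycle_mins_cong: "(\<And>x. orbit \<tau> x = orbit \<sigma> x) \<Longrightarrow> cycle_mins \<alpha> i \<tau> = cycle_mins \<alpha> i \<sigma>"
  by (simp add: cycle_mins_def)

definition real_cycles :: "'n::{finite,linorder} qmat \<Rightarrow> 'n set \<Rightarrow> ('n \<Rightarrow> 'n) \<Rightarrow> real" where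
  "real_cycles H \<beta> \<sigma> = (\<Prod>q | q \<in> \<beta> \<and> q = Min (orbit \<sigma> q). qre (cycle_prod H \<sigma> q))"

text \<open>A form of the principal minor that prefers no row or column. The empty set gets the
  value 1, which the recursion for \<open>coadj\<close> needs at its start.\<close>

definition minor :: "'n::{finite,linorder} qmat \<Rightarrow> 'n set \<Rightarrow> real" where
  "minor H \<beta> = (\<Sum>\<sigma> | \<sigma> permutes \<beta>. csgn \<beta> \<sigma> * real_cycles H \<beta> \<sigma>)"

text \<open>Reindexing by the involution and adding the two copies leaves only symmetrized terms. In
  the applications \<open>r\<close> reverses a cycle and \<open>g\<close> contains the real part of
  its factor.\<close>

lemma sum_involution_average:
  fixes f g :: "'a \<Rightarrow> 'b::real_vector"
  assumes "\<And>x. x \<in> S \<Longrightarrow> r x \<in> S" "\<And>x. x \<in> S \<Longrightarrow> r (r x) = x"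
    and "\<And>x. x \<in> S \<Longrightarrow> f x + f (r x) = 2 *\<^sub>R g x"
  shows "sum f S = sum g S"
proof -
  have "sum f S = (\<Sum>x\<in>S. f (r x))"
    by (rule sum.reindex_bij_witness[of _ r r]) (use assms in auto)
  then have "2 *\<^sub>R sum f S = (\<Sum>x\<in>S. f x + f (r x))"
    by (simp add: sum.distrib scaleR_2)
  also have "\<dots> = (\<Sum>x\<in>S. 2 *\<^sub>R g x)"
    by (rule sum.cong) (use assms in auto)
  also have "\<dots> = 2 *\<^sub>R sum g S"
    by (simp add: scaleR_sum_right)
  finally show ?thesis by simp
qed

lemma set_cycle_mins: "set (cycle_mins \<alpha> i \<sigma>) = {p \<in> \<alpha>. i \<notin> orbit \<sigma> p \<and> p = Min (orbit \<sigma> p)}"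
  by (simp add: cycle_mins_def)

lemma distinct_cycle_mins: "distinct (cycle_mins \<alpha> i \<sigma>)"
  by (simp add: cycle_mins_def)

lemma mem_mins_unique:
  assumes "permutation \<sigma>" and "p = Min (orbit \<sigma> p)" "q = Min (orbit \<sigma> q)" "q \<in> orbit \<sigma> p"
  shows "q = p"
  using assms orbit_eq_orbit by metis

text \<open>
  Reversing a cycle of a permutation conjugates the factor which that cycle contributes for a
  Hermitian matrix; averaging over the reversals of one cycle after the other thus replaces every
  factor by its real part, after which the order of the factors is immaterial.
\<close>

lemma sum_ordered_cycles_eq_real:
  fixes H :: "'n::{finite,linorder} qmat"
  assumes H: "qhermitian H"
    and perm: "\<And>\<sigma>. \<sigma> \<in> S \<Longrightarrow> permutation \<sigma>"
    and closed: "\<And>\<sigma> q. \<sigma> \<in> S \<Longrightarrow> i \<notin> orbit \<sigma> q \<Longrightarrow> cycle_reverse q \<sigma> \<in> S"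
    and inv_a: "\<And>\<sigma> q. \<sigma> \<in> S \<Longrightarrow> i \<notin> orbit \<sigma> q \<Longrightarrow> a (cycle_reverse q \<sigma>) = a \<sigma>"
  shows "(\<Sum>\<sigma>\<in>S. prod_list (map (cycle_prod H \<sigma>) (rev (cycle_mins \<alpha> i \<sigma>))) * a \<sigma>) =
    (\<Sum>\<sigma>\<in>S. (\<Prod>q\<in>set (cycle_mins \<alpha> i \<sigma>). qre (cycle_prod H \<sigma> q)) *\<^sub>R a \<sigma>)"
proof -
  have adj: "qadj H = H" using H by (simp add: qhermitian_def)
  \<comment> \<open>\<open>Q\<close> holds the labels whose cycles have already been averaged;
    enlarging it label by label up to \<open>UNIV\<close> makes all these factors real.\<close>
  define \<phi> where "\<phi> Q \<sigma> q = (if q \<in> Q then of_real (qre (cycle_prod H \<sigma> q)) else cycle_prod H \<sigma> q)"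
    for Q \<sigma> q
  have step: "(\<Sum>\<sigma>\<in>S. prod_list (map (cycle_prod H \<sigma>) (rev (cycle_mins \<alpha> i \<sigma>))) * a \<sigma>) =
    (\<Sum>\<sigma>\<in>S. prod_list (map (\<phi> Q \<sigma>) (rev (cycle_mins \<alpha> i \<sigma>))) * a \<sigma>)" for Q
    using finite[of Q]
  proof (induction Q rule: finite_induct)
    case empty show ?case by (simp add: \<phi>_def cong: map_cong)
  next
    case (insert q Q)
    \<comment> \<open>A label that represents no cycle contributes no factor, so the involution does
      nothing there. The test depends on orbits only and has the same outcome for
      \<open>r \<sigma>\<close>.\<close>
    define r where "r \<sigma> = (if q \<in> set (cycle_mins \<alpha> i \<sigma>) then cycle_reverse q \<sigma> else \<sigma>)" for \<sigma>
    have mins_r: "cycle_mins \<alpha> i (r \<sigma>) = cycle_mins \<alpha> i \<sigma>" if "\<sigma> \<in> S" for \<sigma>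
      by (rule cycle_mins_cong) (simp add: r_def orbit_cycle_reverse perm that)
    have "(\<Sum>\<sigma>\<in>S. prod_list (map (\<phi> Q \<sigma>) (rev (cycle_mins \<alpha> i \<sigma>))) * a \<sigma>) =
      (\<Sum>\<sigma>\<in>S. prod_list (map (\<phi> (insert q Q) \<sigma>) (rev (cycle_mins \<alpha> i \<sigma>))) * a \<sigma>)"
    proof (rule sum_involution_average[where r = r])
      fix \<sigma> assume S: "\<sigma> \<in> S"
      note p = perm[OF S]
      have i_notin: "i \<notin> orbit \<sigma> q" if "q \<in> set (cycle_mins \<alpha> i \<sigma>)"
        using that by (simp add: set_cycle_mins)
      show "r \<sigma> \<in> S" using closed[OF S] i_notin by (simp add: r_def S)
      show "r (r \<sigma>) = \<sigma>"
        unfolding r_def[of "r \<sigma>"] mins_r[OF S] by (simp add: r_def cycle_reverse_cycle_reverse p)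
      show "prod_list (map (\<phi> Q \<sigma>) (rev (cycle_mins \<alpha> i \<sigma>))) * a \<sigma> +
          prod_list (map (\<phi> Q (r \<sigma>)) (rev (cycle_mins \<alpha> i (r \<sigma>)))) * a (r \<sigma>) =
          2 *\<^sub>R (prod_list (map (\<phi> (insert q Q) \<sigma>) (rev (cycle_mins \<alpha> i \<sigma>))) * a \<sigma>)"
      proof (cases "q \<in> set (cycle_mins \<alpha> i \<sigma>)")
        case False
        then have "map (\<phi> (insert q Q) \<sigma>) (rev (cycle_mins \<alpha> i \<sigma>)) = map (\<phi> Q \<sigma>) (rev (cycle_mins \<alpha> i \<sigma>))"
          by (auto simp: \<phi>_def)
        moreover have "r \<sigma> = \<sigma>" using False by (simp add: r_def)
        ultimately show ?thesis by (simp only: scaleR_2)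
      next
        case True
        then obtain xs ys where split: "rev (cycle_mins \<alpha> i \<sigma>) = xs @ q # ys"
          by (metis set_rev split_list)
        have "distinct (xs @ q # ys)" unfolding split[symmetric] by (simp add: distinct_cycle_mins)
        then have q: "q \<notin> set xs" "q \<notin> set ys" by auto
        have other: "x \<notin> orbit \<sigma> q" if "x \<in> set xs \<union> set ys" for x
        proof
          assume "x \<in> orbit \<sigma> q"
          moreover have "x \<in> set (cycle_mins \<alpha> i \<sigma>)"
            using that by (subst set_rev[symmetric], subst split) auto
          ultimately have "x = q"
            using mem_mins_unique[OF p] True by (auto simp: set_cycle_mins)
          then show False using that q by auto
        qed
        have r: "r \<sigma> = cycle_reverse q \<sigma>" using True by (simp add: r_def)
        have 1: "map (\<phi> (insert q Q) \<sigma>) zs = map (\<phi> Q \<sigma>) zs" "map (\<phi> Q (r \<sigma>)) zs = map (\<phi> Q \<sigma>) zs"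
          if "set zs \<subseteq> set xs \<union> set ys" for zs
          using that other q by (auto simp: \<phi>_def r cycle_prod_cycle_reverse[OF p])
        have 2: "\<phi> Q (r \<sigma>) q = qcnj (cycle_prod H \<sigma> q)" "\<phi> Q \<sigma> q = cycle_prod H \<sigma> q"
          "\<phi> (insert q Q) \<sigma> q = of_real (qre (cycle_prod H \<sigma> q))"
          using insert by (simp_all add: \<phi>_def r cycle_prod_cycle_reverse[OF p] adj permutation_self_in_orbit p)
        have 3: "a (r \<sigma>) = a \<sigma>" using inv_a[OF S] i_notin[OF True] by (simp add: r)
        have "u * (cycle_prod H \<sigma> q * v) * w + u * (qcnj (cycle_prod H \<sigma> q) * v) * w
            = 2 *\<^sub>R (u * (of_real (qre (cycle_prod H \<sigma> q)) * v) * w)" for u v w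
        proof -
          have "u * (cycle_prod H \<sigma> q * v) * w + u * (qcnj (cycle_prod H \<sigma> q) * v) * w
            = u * ((cycle_prod H \<sigma> q + qcnj (cycle_prod H \<sigma> q)) * v) * w"
            by (simp only: distrib_left distrib_right)
          then show ?thesis by (simp add: add_qcnj)
        qed
        then show ?thesis
          unfolding mins_r[OF S] split by (simp add: 1 2 3)
      qed
    qed
    then show ?case using insert.IH by simp
  qed
  have "prod_list (map (\<phi> UNIV \<sigma>) (rev (cycle_mins \<alpha> i \<sigma>))) =
    of_real (\<Prod>q\<in>set (cycle_mins \<alpha> i \<sigma>). qre (cycle_prod H \<sigma> q))" for \<sigma>
  proof -
    have *: "prod_list (map (\<lambda>q. of_real (f q) :: quat) xs) = of_real (prod_list (map f xs))" for f and xs :: "'n list"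
      by (induction xs) simp_all
    have "\<phi> UNIV \<sigma> = (\<lambda>q. of_real (qre (cycle_prod H \<sigma> q)))" by (simp add: \<phi>_def fun_eq_iff)
    then have "prod_list (map (\<phi> UNIV \<sigma>) (rev (cycle_mins \<alpha> i \<sigma>))) =
      of_real (prod_list (map (\<lambda>q. qre (cycle_prod H \<sigma> q)) (rev (cycle_mins \<alpha> i \<sigma>))))"
      by (simp only: *)
    also have "prod_list (map (\<lambda>q. qre (cycle_prod H \<sigma> q)) (rev (cycle_mins \<alpha> i \<sigma>))) =
      (\<Prod>q\<in>set (cycle_mins \<alpha> i \<sigma>). qre (cycle_prod H \<sigma> q))"
      using prod.distinct_set_conv_list[of "rev (cycle_mins \<alpha> i \<sigma>)" "\<lambda>q. qre (cycle_prod H \<sigma> q)"]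
      by (simp add: distinct_cycle_mins)
    finally show ?thesis .
  qed
  with step[of UNIV] show ?thesis by (simp add: scaleR_conv_of_real)
qed

section \<open>Determinants with one column replaced\<close>

lemma cycle_prod_repl_col_other:
  assumes "permutation \<sigma>" and "i \<notin> orbit \<sigma> p"
  shows "cycle_prod (repl_col M i c) \<sigma> p = cycle_prod M \<sigma> p"
proof -
  have "(\<sigma> ^^ Suc t) p \<noteq> i" for t
    using funpow_in_orbit[OF permutation_self_in_orbit[OF assms(1)], of "Suc t" p] assms(2) by metis
  then show ?thesis by (simp add: cycle_prod_def repl_col_def)
qed

lemma cycle_prod_repl_col_self:
  assumes "permutation \<sigma>"
  shows "cycle_prod (repl_col M i c) \<sigma> i = open_prod M \<sigma> i * c $ inv \<sigma> i"
proof -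
  have "(\<sigma> ^^ Suc t) i \<noteq> i" if "t < card (orbit \<sigma> i) - 1" for t
  proof -
    have "Suc t < card (orbit \<sigma> i)" using that by simp
    then show ?thesis using inj_onD[OF inj_on_funpow_orbit[OF assms, of i], of "Suc t" 0] by auto
  qed
  then have "open_prod (repl_col M i c) \<sigma> i = open_prod M \<sigma> i"
    unfolding open_prod_def path_prod_def
    by (intro arg_cong[where f = prod_list] map_cong refl) (simp add: repl_col_def)
  then show ?thesis by (simp add: cycle_prod_eq_open_prod[OF assms] repl_col_def)
qed

definition real_cycles_off :: "'n::{finite,linorder} qmat \<Rightarrow> 'n set \<Rightarrow> 'n \<Rightarrow> ('n \<Rightarrow> 'n) \<Rightarrow> real" where
  "real_cycles_off H \<beta> i \<sigma> =
     (\<Prod>q | q \<in> \<beta> \<and> i \<notin> orbit \<sigma> q \<and> q = Min (orbit \<sigma> q). qre (cycle_prod H \<sigma> q))"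

lemma cycle_reverse_outside:
  assumes "permutation \<sigma>" and "i \<notin> orbit \<sigma> q"
  shows "open_prod M (cycle_reverse q \<sigma>) i = open_prod M \<sigma> i"
    and "inv (cycle_reverse q \<sigma>) i = inv \<sigma> i"
proof -
  have agree: "cycle_reverse q \<sigma> y = \<sigma> y" if "y \<in> orbit \<sigma> i" for y
    using that assms by (auto simp: cycle_reverse_def) (metis mem_orbit_commute orbit_eq_orbit)
  show "open_prod M (cycle_reverse q \<sigma>) i = open_prod M \<sigma> i"
    unfolding open_prod_def orbit_cycle_reverse[OF assms(1)]
    by (rule path_prod_cong) (rule funpow_cong_orbit[OF assms(1) agree])
  show "inv (cycle_reverse q \<sigma>) i = inv \<sigma> i"
  proof (rule inv_f_eq)
    show "inj (cycle_reverse q \<sigma>)"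
      using permutation_bijective[OF permutation_cycle_reverse[OF assms(1)]] by (rule bij_is_inj)
    have "inv \<sigma> i \<in> orbit \<sigma> i"
      by (simp add: orbit_invariant assms permutation_self_in_orbit)
    then show "cycle_reverse q \<sigma> (inv \<sigma> i) = i"
      using permutation_bijective[OF assms(1)] by (simp add: agree bij_is_surj surj_f_inv_f)
  qed
qed

text \<open>With a replaced column the matrix is in general not Hermitian, but only the cycle
  through \<open>i\<close> reads that column. All other cycles can be averaged, and the entry of
  \<open>c\<close> stands rightmost in every term.\<close>

lemma cdet_repl_col:
  fixes H :: "'n::{finite,linorder} qmat"
  assumes "qhermitian H"
  shows "cdet \<beta> i (repl_col H i c) =
    (\<Sum>\<sigma> | \<sigma> permutes \<beta>. (csgn \<beta> \<sigma> * real_cycles_off H \<beta> i \<sigma>) *\<^sub>R (open_prod H \<sigma> i * c $ inv \<sigma> i))"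
proof -
  let ?S = "{\<sigma>. \<sigma> permutes \<beta>}"
  have p: "permutation \<sigma>" if "\<sigma> \<in> ?S" for \<sigma> using that permutation_if_permutes by blast
  let ?a = "\<lambda>\<sigma>. csgn \<beta> \<sigma> *\<^sub>R (open_prod H \<sigma> i * c $ inv \<sigma> i)"
  have "cdet \<beta> i (repl_col H i c) =
    (\<Sum>\<sigma>\<in>?S. prod_list (map (cycle_prod H \<sigma>) (rev (cycle_mins \<beta> i \<sigma>))) * ?a \<sigma>)"
    unfolding cdet_def
  proof (rule sum.cong[OF refl])
    fix \<sigma> assume S: "\<sigma> \<in> ?S"
    have e: "map (cycle_prod (repl_col H i c) \<sigma>) (rev (cycle_mins \<beta> i \<sigma>)) =
      map (cycle_prod H \<sigma>) (rev (cycle_mins \<beta> i \<sigma>))"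
      by (rule map_cong[OF refl]) (simp add: set_cycle_mins cycle_prod_repl_col_other p[OF S])
    show "cycle_sign \<beta> \<sigma> * (prod_list (map (cycle_prod (repl_col H i c) \<sigma>) (rev (cycle_mins \<beta> i \<sigma>))) *
        cycle_prod (repl_col H i c) \<sigma> i) =
      prod_list (map (cycle_prod H \<sigma>) (rev (cycle_mins \<beta> i \<sigma>))) * ?a \<sigma>"
      unfolding e by (simp add: cycle_sign_eq cycle_prod_repl_col_self[OF p[OF S]] scaleR_conv_of_real[symmetric])
  qed
  also have "\<dots> = (\<Sum>\<sigma>\<in>?S. (\<Prod>q\<in>set (cycle_mins \<beta> i \<sigma>). qre (cycle_prod H \<sigma> q)) *\<^sub>R ?a \<sigma>)"
  proof (rule sum_ordered_cycles_eq_real[OF assms p])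
    fix \<sigma> q assume S: "\<sigma> \<in> ?S" and "i \<notin> orbit \<sigma> q"
    then show "?a (cycle_reverse q \<sigma>) = ?a \<sigma>" "cycle_reverse q \<sigma> \<in> ?S"
      using p[OF S] csgn_cong[OF orbit_cycle_reverse, of \<sigma> \<beta> q]
      by (simp_all add: cycle_reverse_outside permutes_cycle_reverse)
  qed
  finally show ?thesis by (simp add: set_cycle_mins real_cycles_off_def mult.commute)
qed

lemma repl_col_column [simp]: "repl_col M i (column i M) = M"
  by (simp add: repl_col_def column_def vec_eq_iff)

text \<open>\<open>real_cycles\<close> represents the cycle through \<open>i\<close> by its least
  label instead of \<open>i\<close>; the real part is the same for both.\<close>

lemma real_cycles_eq_off:
  fixes H :: "'n::{finite,linorder} qmat"
  assumes "\<sigma> permutes \<beta>" and "i \<in> \<beta>"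
  shows "real_cycles H \<beta> \<sigma> = real_cycles_off H \<beta> i \<sigma> * qre (cycle_prod H \<sigma> i)"
proof -
  have p: "permutation \<sigma>" by (rule permutation_if_permutes[OF assms(1)])
  let ?m = "Min (orbit \<sigma> i)"
  let ?N = "{q \<in> \<beta>. i \<notin> orbit \<sigma> q \<and> q = Min (orbit \<sigma> q)}"
  have m: "?m \<in> orbit \<sigma> i" by (simp add: Min_in orbit_nonempty)
  have om: "orbit \<sigma> ?m = orbit \<sigma> i" by (rule orbit_eq_orbit[OF p m])
  have "q \<in> {q \<in> \<beta>. q = Min (orbit \<sigma> q)} \<longleftrightarrow> q \<in> insert ?m ?N" for q
  proof (cases "i \<in> orbit \<sigma> q")
    case True
    then have "orbit \<sigma> q = orbit \<sigma> i" using orbit_eq_orbit[OF p] by blast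
    then show ?thesis using True m om permutes_orbit_subset[OF assms] by auto
  next
    case False
    then have "q \<noteq> ?m" using om permutation_self_in_orbit[OF p, of i] by auto
    then show ?thesis using False by simp
  qed
  then have "{q \<in> \<beta>. q = Min (orbit \<sigma> q)} = insert ?m ?N" by blast
  moreover have "?m \<notin> ?N" using om permutation_self_in_orbit[OF p] by auto
  ultimately have "real_cycles H \<beta> \<sigma> = qre (cycle_prod H \<sigma> ?m) * real_cycles_off H \<beta> i \<sigma>"
    by (simp add: real_cycles_def real_cycles_off_def)
  then show ?thesis using qre_cycle_prod_orbit[OF p m] by simp
qed

lemma real_cycles_off_cong:
  assumes "\<And>q. i \<notin> orbit \<sigma> q \<Longrightarrow> cycle_prod H \<tau> q = cycle_prod H \<sigma> q"
    and "\<And>q. orbit \<tau> q = orbit \<sigma> q"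
  shows "real_cycles_off H \<beta> i \<tau> = real_cycles_off H \<beta> i \<sigma>"
  unfolding real_cycles_off_def assms(2) by (rule prod.cong) (auto simp: assms(1))

text \<open>Once the other cycles are real, one more averaging, over the reversal of the cycle
  through \<open>i\<close> itself, removes the dependence on \<open>i\<close>.\<close>

lemma cdet_hermitian:
  fixes H :: "'n::{finite,linorder} qmat"
  assumes "qhermitian H" and "i \<in> \<beta>"
  shows "cdet \<beta> i H = of_real (minor H \<beta>)"
proof -
  have adj: "qadj H = H" using assms(1) by (simp add: qhermitian_def)
  have "cdet \<beta> i H = cdet \<beta> i (repl_col H i (column i H))" by simp
  also have "\<dots> = (\<Sum>\<sigma> | \<sigma> permutes \<beta>. (csgn \<beta> \<sigma> * real_cycles_off H \<beta> i \<sigma>) *\<^sub>R cycle_prod H \<sigma> i)"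
    unfolding cdet_repl_col[OF assms(1)]
    by (rule sum.cong) (auto simp: cycle_prod_eq_open_prod permutation_if_permutes column_def)
  also have "\<dots> = (\<Sum>\<sigma> | \<sigma> permutes \<beta>. of_real (csgn \<beta> \<sigma> * real_cycles H \<beta> \<sigma>))"
  proof (rule sum_involution_average[where r = "cycle_reverse i"])
    fix \<sigma> assume "\<sigma> \<in> {\<sigma>. \<sigma> permutes \<beta>}"
    then have S: "\<sigma> permutes \<beta>" and p: "permutation \<sigma>" using permutation_if_permutes by auto
    show "cycle_reverse i \<sigma> \<in> {\<sigma>. \<sigma> permutes \<beta>}" by (simp add: permutes_cycle_reverse[OF S])
    show "cycle_reverse i (cycle_reverse i \<sigma>) = \<sigma>" by (rule cycle_reverse_cycle_reverse[OF p])
    have 1: "real_cycles_off H \<beta> i (cycle_reverse i \<sigma>) = real_cycles_off H \<beta> i \<sigma>"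
      by (rule real_cycles_off_cong)
         (simp_all add: orbit_cycle_reverse[OF p] cycle_prod_cycle_reverse[OF p] mem_orbit_commute[OF p, of _ i])
    have 2: "csgn \<beta> (cycle_reverse i \<sigma>) = csgn \<beta> \<sigma>"
      by (rule csgn_cong) (rule orbit_cycle_reverse[OF p])
    have 3: "cycle_prod H (cycle_reverse i \<sigma>) i = qcnj (cycle_prod H \<sigma> i)"
      by (simp add: cycle_prod_cycle_reverse[OF p] permutation_self_in_orbit[OF p] adj)
    show "(csgn \<beta> \<sigma> * real_cycles_off H \<beta> i \<sigma>) *\<^sub>R cycle_prod H \<sigma> i +
      (csgn \<beta> (cycle_reverse i \<sigma>) * real_cycles_off H \<beta> i (cycle_reverse i \<sigma>)) *\<^sub>R cycle_prod H (cycle_reverse i \<sigma>) i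
      = 2 *\<^sub>R of_real (csgn \<beta> \<sigma> * real_cycles H \<beta> \<sigma>)"
      unfolding 1 2 3 scaleR_add_right[symmetric] add_qcnj real_cycles_eq_off[OF S assms(2)]
      by (simp add: of_real_def mult_ac)
  qed
  finally show ?thesis by (simp add: minor_def)
qed

section \<open>Joining two cycles\<close>

text \<open>A transposition applied after \<open>\<tau>\<close>: for distinct \<open>i\<close> and
  \<open>p\<close> it joins their cycles if these differ, and otherwise cuts the common cycle in
  two.\<close>

definition post_swap :: "'a \<Rightarrow> 'a \<Rightarrow> ('a \<Rightarrow> 'a) \<Rightarrow> 'a \<Rightarrow> 'a" where
  "post_swap i p \<tau> x = (if \<tau> x = i then p else if \<tau> x = p then i else \<tau> x)"

lemma post_swap_commute: "post_swap i p \<tau> = post_swap p i \<tau>"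
  by (auto simp: post_swap_def fun_eq_iff)

lemma post_swap_post_swap: "post_swap i p (post_swap i p \<tau>) = \<tau>"
  by (auto simp: post_swap_def fun_eq_iff)

lemma post_swap_eq_transpose: "post_swap i p \<tau> = Transposition.transpose i p \<circ> \<tau>"
  by (auto simp: post_swap_def fun_eq_iff Transposition.transpose_def)

lemma permutes_post_swap:
  "\<tau> permutes \<beta> \<Longrightarrow> i \<in> \<beta> \<Longrightarrow> p \<in> \<beta> \<Longrightarrow> post_swap i p \<tau> permutes \<beta>"
  unfolding post_swap_eq_transpose by (intro permutes_compose permutes_swap_id)

lemma permutation_post_swap:
  fixes \<tau> :: "'n::finite \<Rightarrow> 'n"
  shows "permutation \<tau> \<Longrightarrow> permutation (post_swap i p \<tau>)"
  unfolding post_swap_eq_transpose by (intro permutation_compose permutation_swap_id)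

lemma inv_post_swap:
  fixes \<tau> :: "'n::finite \<Rightarrow> 'n"
  assumes "permutation \<tau>"
  shows "inv (post_swap i p \<tau>) i = inv \<tau> p"
proof (rule inv_f_eq)
  show "inj (post_swap i p \<tau>)"
    using permutation_bijective[OF permutation_post_swap[OF assms]] by (rule bij_is_inj)
  show "post_swap i p \<tau> (inv \<tau> p) = i"
    using permutation_bijective[OF assms] by (simp add: post_swap_def bij_is_surj surj_f_inv_f)
qed

text \<open>The joined cycle runs through the old cycle of \<open>i\<close> and, where that would
  return to \<open>i\<close>, jumps to \<open>p\<close>.\<close>

lemma funpow_post_swap:
  assumes "permutation \<tau>" and "p \<notin> orbit \<tau> i"
  shows "t < card (orbit \<tau> i) \<Longrightarrow> (post_swap i p \<tau> ^^ t) i = (\<tau> ^^ t) i"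
    and "(post_swap i p \<tau> ^^ card (orbit \<tau> i)) i = p"
proof -
  show *: "(post_swap i p \<tau> ^^ t) i = (\<tau> ^^ t) i" if "t < card (orbit \<tau> i)" for t
    using that
  proof (induction t)
    case (Suc t)
    have "(\<tau> ^^ Suc t) i \<noteq> i"
      using inj_onD[OF inj_on_funpow_orbit[OF assms(1), of i], of "Suc t" 0] Suc.prems by auto
    moreover have "(\<tau> ^^ Suc t) i \<noteq> p"
      using funpow_in_orbit[OF permutation_self_in_orbit[OF assms(1)], of "Suc t" i] assms(2) by metis
    ultimately show ?case using Suc by (simp add: post_swap_def)
  qed simp
  obtain m where m: "card (orbit \<tau> i) = Suc m"
    using card_orbit_pos[OF assms(1), of i] gr0_implies_Suc by blast
  have "\<tau> ((\<tau> ^^ m) i) = i" using funpow_card_orbit[OF assms(1), of i] m by simp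
  then show "(post_swap i p \<tau> ^^ card (orbit \<tau> i)) i = p"
    using *[of m] by (simp add: m post_swap_def)
qed

lemma orbits_disjoint:
  assumes "permutation \<tau>" and "p \<notin> orbit \<tau> i"
  shows "orbit \<tau> i \<inter> orbit \<tau> p = {}"
  using assms orbit_eq_orbit permutation_self_in_orbit by (metis disjoint_iff)

text \<open>Read from \<open>i\<close>, the joined cycle is the open cycle of \<open>i\<close>, the
  step from \<open>inv \<tau> i\<close> to \<open>p\<close>, and the open cycle of \<open>p\<close>;
  its own closing step leads from \<open>inv \<tau> p\<close> back to \<open>i\<close>.\<close>

lemma
  fixes \<tau> :: "'n::finite \<Rightarrow> 'n"
  assumes "permutation \<tau>" and "p \<notin> orbit \<tau> i"
  shows orbit_post_swap: "orbit (post_swap i p \<tau>) i = orbit \<tau> i \<union> orbit \<tau> p"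
    and open_prod_post_swap: "open_prod M (post_swap i p \<tau>) i = open_prod M \<tau> i * M $ inv \<tau> i $ p * open_prod M \<tau> p"
proof -
  let ?\<sigma> = "post_swap i p \<tau>" and ?a = "card (orbit \<tau> i)" and ?b = "card (orbit \<tau> p)"
  have i: "i \<notin> orbit \<tau> p" using assms mem_orbit_commute by metis
  note 1 = funpow_post_swap[OF assms]
  note 2 = funpow_post_swap[OF assms(1) i, folded post_swap_commute[of i p]]
  have shift: "(?\<sigma> ^^ (?a + t)) i = (?\<sigma> ^^ t) p" for t
    by (simp add: add.commute[of ?a t] funpow_add 1)
  have "orbit ?\<sigma> i = {(?\<sigma> ^^ t) i | t. t < ?a + ?b}"
    by (rule orbit_altdef_bounded) (simp_all add: shift 2 card_orbit_pos assms(1))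
  also have "\<dots> = (\<lambda>t. (?\<sigma> ^^ t) i) ` {..<?a} \<union> (\<lambda>t. (?\<sigma> ^^ (?a + t)) i) ` {..<?b}"
  proof -
    have "t < ?a \<or> (\<exists>u<?b. t = ?a + u)" if "t < ?a + ?b" for t
      using that by presburger
    then show ?thesis by (fastforce simp: image_iff)
  qed
  also have "(\<lambda>t. (?\<sigma> ^^ t) i) ` {..<?a} = orbit \<tau> i"
    by (subst orbit_eq_image[OF assms(1)]) (simp add: 1)
  also have "(\<lambda>t. (?\<sigma> ^^ (?a + t)) i) ` {..<?b} = orbit \<tau> p"
    by (subst orbit_eq_image[OF assms(1), of p]) (simp add: shift 2)
  finally show o: "orbit ?\<sigma> i = orbit \<tau> i \<union> orbit \<tau> p" .
  have c: "card (orbit ?\<sigma> i) = ?a + ?b"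
    unfolding o by (rule card_Un_disjoint) (simp_all add: orbits_disjoint[OF assms])
  obtain a b where ab: "?a = Suc a" "?b = Suc b"
    using card_orbit_pos[OF assms(1)] gr0_implies_Suc by metis
  have l: "(\<tau> ^^ a) i = inv \<tau> i"
    using funpow_card_orbit_minus_1[OF assms(1), of i] ab by simp
  have "open_prod M ?\<sigma> i = path_prod M ?\<sigma> i (Suc a + b)" by (simp add: open_prod_def c ab)
  also have "\<dots> = path_prod M ?\<sigma> i a * M $ ((?\<sigma> ^^ a) i) $ ((?\<sigma> ^^ Suc a) i) * path_prod M ?\<sigma> ((?\<sigma> ^^ Suc a) i) b"
    by (simp only: path_prod_add path_prod_Suc)
  also have "(?\<sigma> ^^ Suc a) i = p" using 1(2) ab by simp
  also have "(?\<sigma> ^^ a) i = inv \<tau> i" using 1(1)[of a] ab l by simp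
  also have "path_prod M ?\<sigma> i a = open_prod M \<tau> i"
    unfolding open_prod_def using ab by (auto intro!: path_prod_cong 1)
  also have "path_prod M ?\<sigma> p b = open_prod M \<tau> p"
    unfolding open_prod_def using ab by (auto intro!: path_prod_cong 2)
  finally show "open_prod M ?\<sigma> i = open_prod M \<tau> i * M $ inv \<tau> i $ p * open_prod M \<tau> p" .
qed

lemma post_swap_outside:
  fixes \<tau> :: "'n::finite \<Rightarrow> 'n"
  assumes "permutation \<tau>" and "q \<notin> orbit \<tau> i" "q \<notin> orbit \<tau> p"
  shows "orbit (post_swap i p \<tau>) q = orbit \<tau> q" "cycle_prod M (post_swap i p \<tau>) q = cycle_prod M \<tau> q"
proof -
  have "post_swap i p \<tau> y = \<tau> y" if "y \<in> orbit \<tau> q" for y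
  proof -
    have "\<tau> y \<in> orbit \<tau> q" using that by (rule orbit.step)
    then have "\<tau> y \<noteq> i" "\<tau> y \<noteq> p" using assms mem_orbit_commute by metis+
    then show ?thesis by (simp add: post_swap_def)
  qed
  then show "orbit (post_swap i p \<tau>) q = orbit \<tau> q" "cycle_prod M (post_swap i p \<tau>) q = cycle_prod M \<tau> q"
    using orbit_cong_permutation[OF assms(1)] cycle_prod_cong[OF assms(1)] by metis+
qed

lemma csgn_post_swap:
  fixes \<tau> :: "'n::finite \<Rightarrow> 'n"
  assumes "permutation \<tau>" and "p \<notin> orbit \<tau> i" "i \<in> \<beta>" "p \<in> \<beta>"
  shows "csgn \<beta> (post_swap i p \<tau>) = - csgn \<beta> \<tau>"
proof -
  let ?\<sigma> = "post_swap i p \<tau>" and ?U = "orbit \<tau> i \<union> orbit \<tau> p"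
  let ?R = "orbit \<tau> ` (\<beta> - ?U)"
  have i: "i \<notin> orbit \<tau> p" using assms mem_orbit_commute by metis
  have self: "x \<in> orbit \<tau> x" for x by (rule permutation_self_in_orbit[OF assms(1)])
  have orb: "orbit \<tau> x = orbit \<tau> y" if "x \<in> orbit \<tau> y" for x y using orbit_eq_orbit[OF assms(1) that] .
  have U: "orbit ?\<sigma> x = ?U" if "x \<in> ?U" for x
    using orbit_eq_orbit[OF permutation_post_swap[OF assms(1)], of x i p i] orbit_post_swap[OF assms(1,2)] that by simp
  have "orbit ?\<sigma> ` \<beta> = insert ?U ?R"
  proof -
    have "orbit ?\<sigma> ` \<beta> = orbit ?\<sigma> ` (\<beta> \<inter> ?U) \<union> orbit ?\<sigma> ` (\<beta> - ?U)" by blast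
    also have "orbit ?\<sigma> ` (\<beta> \<inter> ?U) = {?U}" using U assms(3) self by (auto simp: image_iff)
    also have "orbit ?\<sigma> ` (\<beta> - ?U) = ?R" by (rule image_cong) (auto simp: post_swap_outside assms(1))
    finally show ?thesis by simp
  qed
  moreover have "?U \<notin> ?R" using self by (auto simp: image_iff)
  ultimately have c1: "card (orbit ?\<sigma> ` \<beta>) = Suc (card ?R)" by simp
  have "orbit \<tau> ` \<beta> = insert (orbit \<tau> i) (insert (orbit \<tau> p) ?R)"
  proof -
    have "orbit \<tau> ` \<beta> = orbit \<tau> ` (\<beta> \<inter> ?U) \<union> ?R" by blast
    also have "orbit \<tau> ` (\<beta> \<inter> ?U) = {orbit \<tau> i, orbit \<tau> p}"
    proof
      show "orbit \<tau> ` (\<beta> \<inter> ?U) \<subseteq> {orbit \<tau> i, orbit \<tau> p}" using orb by blast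
      show "{orbit \<tau> i, orbit \<tau> p} \<subseteq> orbit \<tau> ` (\<beta> \<inter> ?U)" using self assms(3,4) by blast
    qed
    finally show ?thesis by simp
  qed
  moreover have "orbit \<tau> i \<notin> insert (orbit \<tau> p) ?R" "orbit \<tau> p \<notin> ?R"
    using self i by (auto simp: image_iff)
  ultimately have c2: "card (orbit \<tau> ` \<beta>) = Suc (Suc (card ?R))" by simp
  \<comment> \<open>The exponent of \<open>csgn\<close> is a difference of naturals; this bound
    ensures that it really grows by one when two cycles become one.\<close>
  have "card (orbit \<tau> ` \<beta>) \<le> card \<beta>" by (simp add: card_image_le)
  then have "card \<beta> - card (orbit ?\<sigma> ` \<beta>) = Suc (card \<beta> - card (orbit \<tau> ` \<beta>))"
    using c1 c2 by simp
  then show ?thesis by (simp add: csgn_def)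
qed

lemma real_cycles_off_post_swap:
  fixes \<tau> :: "'n::{finite,linorder} \<Rightarrow> 'n"
  assumes "permutation \<tau>" and "p \<notin> orbit \<tau> i"
  shows "real_cycles_off H \<beta> i (post_swap i p \<tau>) =
    (\<Prod>q | q \<in> \<beta> \<and> i \<notin> orbit \<tau> q \<and> p \<notin> orbit \<tau> q \<and> q = Min (orbit \<tau> q). qre (cycle_prod H \<tau> q))"
  unfolding real_cycles_off_def
proof (rule prod.cong)
  let ?\<sigma> = "post_swap i p \<tau>"
  have q: "i \<in> orbit ?\<sigma> q \<longleftrightarrow> i \<in> orbit \<tau> q \<or> p \<in> orbit \<tau> q" for q
    using orbit_post_swap[OF assms] mem_orbit_commute[OF permutation_post_swap[OF assms(1)], of i i p q]
      mem_orbit_commute[OF assms(1)] by simp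
  have out: "orbit ?\<sigma> q = orbit \<tau> q" "cycle_prod H ?\<sigma> q = cycle_prod H \<tau> q"
    if "i \<notin> orbit \<tau> q" "p \<notin> orbit \<tau> q" for q
    using that post_swap_outside[OF assms(1)] mem_orbit_commute[OF assms(1)] by metis+
  show "{q \<in> \<beta>. i \<notin> orbit ?\<sigma> q \<and> q = Min (orbit ?\<sigma> q)} =
    {q \<in> \<beta>. i \<notin> orbit \<tau> q \<and> p \<notin> orbit \<tau> q \<and> q = Min (orbit \<tau> q)}"
    using out by (auto simp: q)
  show "qre (cycle_prod H ?\<sigma> x) = qre (cycle_prod H \<tau> x)"
    if "x \<in> {q \<in> \<beta>. i \<notin> orbit \<tau> q \<and> p \<notin> orbit \<tau> q \<and> q = Min (orbit \<tau> q)}" for x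
    using that out by simp
qed

lemma real_cycles_off_eq:
  fixes H :: "'n::{finite,linorder} qmat"
  assumes "\<tau> permutes \<beta>" and "p \<in> \<beta>" "p \<notin> orbit \<tau> i"
  shows "real_cycles_off H \<beta> i \<tau> = real_cycles_off H \<beta> i (post_swap i p \<tau>) * qre (cycle_prod H \<tau> p)"
proof -
  have P: "permutation \<tau>" by (rule permutation_if_permutes[OF assms(1)])
  let ?m = "Min (orbit \<tau> p)"
  let ?N = "{q \<in> \<beta>. i \<notin> orbit \<tau> q \<and> p \<notin> orbit \<tau> q \<and> q = Min (orbit \<tau> q)}"
  have i: "i \<notin> orbit \<tau> p" using assms(3) P mem_orbit_commute by metis
  have m: "?m \<in> orbit \<tau> p" by (simp add: Min_in orbit_nonempty)
  have om: "orbit \<tau> ?m = orbit \<tau> p" by (rule orbit_eq_orbit[OF P m])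
  have "q \<in> {q \<in> \<beta>. i \<notin> orbit \<tau> q \<and> q = Min (orbit \<tau> q)} \<longleftrightarrow> q \<in> insert ?m ?N" for q
  proof (cases "p \<in> orbit \<tau> q")
    case True
    then have "orbit \<tau> q = orbit \<tau> p" using orbit_eq_orbit[OF P] by blast
    then show ?thesis using True m om i permutes_orbit_subset[OF assms(1,2)] by auto
  next
    case False
    then have "q \<noteq> ?m" using om permutation_self_in_orbit[OF P, of p] by auto
    then show ?thesis using False by simp
  qed
  then have "{q \<in> \<beta>. i \<notin> orbit \<tau> q \<and> q = Min (orbit \<tau> q)} = insert ?m ?N" by blast
  moreover have "?m \<notin> ?N" using om permutation_self_in_orbit[OF P, of p] by auto
  ultimately show ?thesis
    unfolding real_cycles_off_post_swap[OF P assms(3)]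
    by (simp add: real_cycles_off_def qre_cycle_prod_orbit[OF P m])
qed

text \<open>From \<open>i\<close> the new permutation follows \<open>\<sigma>\<close> up to the
  predecessor of \<open>p\<close> and there returns to \<open>i\<close>, so its cycle closes before
  \<open>p\<close> is met.\<close>

lemma post_swap_separates:
  fixes \<sigma> :: "'n::finite \<Rightarrow> 'n"
  assumes "permutation \<sigma>" and "p \<in> orbit \<sigma> i" "p \<noteq> i"
  shows "p \<notin> orbit (post_swap i p \<sigma>) i"
proof
  assume p_in: "p \<in> orbit (post_swap i p \<sigma>) i"
  \<comment> \<open>\<open>P t\<close> says that \<open>p\<close> is met after \<open>Suc t\<close>
    steps; the least such \<open>t\<close> is the position of the predecessor of \<open>p\<close>,
    not of \<open>p\<close> itself.\<close>
  define P where "P t \<longleftrightarrow> (\<sigma> ^^ Suc t) i = p" for t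
  have "\<exists>t. P t"
    using assms(2) unfolding orbit_altdef P_def using gr0_implies_Suc by blast
  then have l: "P (LEAST t. P t)" by (rule LeastI_ex)
  have least: "\<not> P u" if "u < (LEAST t. P t)" for u
    using that by (rule not_less_Least)
  define t where "t = (LEAST t. P t)"
  have "\<exists>a<card (orbit \<sigma> i). (\<sigma> ^^ a) i = p"
    using subst[OF orbit_eq_image[OF assms(1), of i], of "\<lambda>S. p \<in> S", OF assms(2)] by auto
  then obtain a where a: "a < card (orbit \<sigma> i)" "(\<sigma> ^^ a) i = p" by blast
  then obtain a' where a': "a = Suc a'" using assms(3) by (cases a) auto
  have "t \<le> a'" unfolding t_def by (rule Least_le) (use a a' in \<open>simp add: P_def\<close>)
  then have t: "Suc t < card (orbit \<sigma> i)" using a a' by simp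
  have pow: "(post_swap i p \<sigma> ^^ u) i = (\<sigma> ^^ u) i" if "u \<le> t" for u
    using that
  proof (induction u)
    case (Suc u)
    have "(\<sigma> ^^ Suc u) i \<noteq> p" using least[of u] Suc.prems by (simp add: P_def t_def)
    moreover have "(\<sigma> ^^ Suc u) i \<noteq> i"
      using inj_onD[OF inj_on_funpow_orbit[OF assms(1), of i], of "Suc u" 0] Suc.prems t by auto
    ultimately show ?case using Suc by (simp add: post_swap_def)
  qed simp
  have "(post_swap i p \<sigma> ^^ Suc t) i = i"
    using l assms(3) pow[of t] by (simp add: post_swap_def P_def t_def)
  then have "orbit (post_swap i p \<sigma>) i = {(post_swap i p \<sigma> ^^ u) i | u. u < Suc t}"
    by (rule orbit_altdef_bounded) simp
  then obtain u where "u < Suc t" "p = (post_swap i p \<sigma> ^^ u) i" using p_in by blast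
  then have u: "u \<le> t" "(\<sigma> ^^ u) i = p" using pow[of u] by simp_all
  then obtain u' where "u = Suc u'" using assms(3) by (cases u) auto
  then show False using u least[of u'] by (simp add: P_def t_def)
qed

section \<open>The adjugate recursion\<close>

text \<open>
  The permutations with \<open>i\<close> and \<open>p\<close> in one cycle cancel those with \<open>i\<close> and \<open>p\<close> in
  different cycles: the arc from \<open>p\<close> back to \<open>i\<close> becomes a cycle of its own.
\<close>

lemma cdet_repl_col_column:
  fixes H :: "'n::{finite,linorder} qmat"
  assumes "qhermitian H" and "i \<in> \<beta>" "p \<in> \<beta>" "p \<noteq> i"
  shows "cdet \<beta> i (repl_col H i (column p H)) = 0"
proof -
  have adj: "qadj H = H" using assms(1) by (simp add: qhermitian_def)
  let ?S = "{\<sigma>. \<sigma> permutes \<beta>}"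
  let ?S1 = "{\<sigma>. \<sigma> permutes \<beta> \<and> p \<in> orbit \<sigma> i}" and ?S2 = "{\<sigma>. \<sigma> permutes \<beta> \<and> p \<notin> orbit \<sigma> i}"
  let ?f = "\<lambda>\<sigma>. (csgn \<beta> \<sigma> * real_cycles_off H \<beta> i \<sigma>) *\<^sub>R (open_prod H \<sigma> i * H $ inv \<sigma> i $ p)"
  \<comment> \<open>The value of \<open>?f\<close> at the joined permutation. Its last factor reads
    column \<open>p\<close> in row \<open>inv \<tau> p\<close>; that entry closes the cycle of
    \<open>p\<close>, so a full \<open>cycle_prod H \<tau> p\<close> appears.\<close>
  let ?g = "\<lambda>\<tau>. (- csgn \<beta> \<tau> * real_cycles_off H \<beta> i (post_swap i p \<tau>)) *\<^sub>R
    (open_prod H \<tau> i * H $ inv \<tau> i $ p * cycle_prod H \<tau> p)"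
  have "sum ?f ?S1 = sum ?g ?S2"
  proof (rule sum.reindex_bij_witness[of _ "post_swap i p" "post_swap i p"])
    fix \<sigma> assume "\<sigma> \<in> ?S1"
    then have S: "\<sigma> permutes \<beta>" and o: "p \<in> orbit \<sigma> i" and P: "permutation \<sigma>"
      using permutation_if_permutes by auto
    let ?t = "post_swap i p \<sigma>"
    have Pt: "permutation ?t" by (rule permutation_post_swap[OF P])
    have ot: "p \<notin> orbit ?t i" using o P assms(4) by (intro post_swap_separates)
    show "?t \<in> ?S2" using ot by (simp add: permutes_post_swap S assms)
    show "post_swap i p ?t = \<sigma>" by (rule post_swap_post_swap)
    have *: "open_prod H \<sigma> i = open_prod H ?t i * H $ inv ?t i $ p * open_prod H ?t p"
      "csgn \<beta> \<sigma> = - csgn \<beta> ?t" "inv \<sigma> i = inv ?t p"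
      using open_prod_post_swap[OF Pt ot, of H] csgn_post_swap[OF Pt ot assms(2,3)] inv_post_swap[OF Pt, of i p]
      by (simp_all add: post_swap_post_swap)
    show "?g ?t = ?f \<sigma>"
      unfolding * by (simp add: post_swap_post_swap cycle_prod_eq_open_prod[OF Pt] mult.assoc)
  next
    fix \<tau> assume "\<tau> \<in> ?S2"
    then have S: "\<tau> permutes \<beta>" and o: "p \<notin> orbit \<tau> i" and P: "permutation \<tau>"
      using permutation_if_permutes by auto
    show "post_swap i p \<tau> \<in> ?S1"
      by (simp add: permutes_post_swap S assms orbit_post_swap[OF P o] permutation_self_in_orbit[OF P])
    show "post_swap i p (post_swap i p \<tau>) = \<tau>" by (rule post_swap_post_swap)
  qed
  \<comment> \<open>Averaging over the reversal of the cycle of \<open>p\<close> leaves the real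
    part of its factor, which is exactly what \<open>?f\<close> contains for this cycle through
    \<open>real_cycles_off\<close>.\<close>
  also have "\<dots> = (\<Sum>\<tau>\<in>?S2. - ?f \<tau>)"
  proof (rule sum_involution_average[where r = "cycle_reverse p"])
    fix \<tau> assume "\<tau> \<in> ?S2"
    then have S: "\<tau> permutes \<beta>" and o: "p \<notin> orbit \<tau> i" and P: "permutation \<tau>"
      using permutation_if_permutes by auto
    have i: "i \<notin> orbit \<tau> p" using o P mem_orbit_commute by metis
    show "cycle_reverse p \<tau> \<in> ?S2" using o by (simp add: permutes_cycle_reverse[OF S] orbit_cycle_reverse[OF P])
    show "cycle_reverse p (cycle_reverse p \<tau>) = \<tau>" by (rule cycle_reverse_cycle_reverse[OF P])
    have o': "p \<notin> orbit (cycle_reverse p \<tau>) i" using o by (simp add: orbit_cycle_reverse[OF P])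
    have 1: "real_cycles_off H \<beta> i (post_swap i p (cycle_reverse p \<tau>)) = real_cycles_off H \<beta> i (post_swap i p \<tau>)"
      unfolding real_cycles_off_post_swap[OF P o] real_cycles_off_post_swap[OF permutation_cycle_reverse[OF P] o']
        orbit_cycle_reverse[OF P]
      by (rule prod.cong) (auto simp: cycle_prod_cycle_reverse[OF P] mem_orbit_commute[OF P, of _ p])
    have 2: "csgn \<beta> (cycle_reverse p \<tau>) = csgn \<beta> \<tau>"
      by (rule csgn_cong) (rule orbit_cycle_reverse[OF P])
    have 3: "cycle_prod H (cycle_reverse p \<tau>) p = qcnj (cycle_prod H \<tau> p)"
      by (simp add: cycle_prod_cycle_reverse[OF P] permutation_self_in_orbit[OF P] adj)
    have "?g \<tau> + ?g (cycle_reverse p \<tau>) = (- csgn \<beta> \<tau> * real_cycles_off H \<beta> i (post_swap i p \<tau>)) *\<^sub>R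
        (open_prod H \<tau> i * H $ inv \<tau> i $ p * (cycle_prod H \<tau> p + qcnj (cycle_prod H \<tau> p)))"
      unfolding 1 2 3 cycle_reverse_outside[OF P i] by (simp only: distrib_left scaleR_add_right)
    also have "\<dots> = 2 *\<^sub>R (- ?f \<tau>)"
      unfolding add_qcnj real_cycles_off_eq[OF S assms(3) o]
      by (simp add: of_real_def mult_ac)
    finally show "?g \<tau> + ?g (cycle_reverse p \<tau>) = 2 *\<^sub>R (- ?f \<tau>)" .
  qed
  finally have "sum ?f ?S1 + sum ?f ?S2 = 0" by (simp add: sum_negf)
  moreover have "sum ?f ?S = sum ?f ?S1 + sum ?f ?S2"
    by (subst sum.union_disjoint[symmetric]) (auto intro!: sum.cong)
  ultimately have "sum ?f ?S = 0" by simp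
  then show ?thesis by (simp add: cdet_repl_col[OF assms(1)] column_def)
qed

section \<open>Unit columns and label sets enlarged by one label\<close>

lemma cdet_repl_col_linear:
  fixes H :: "'n::{finite,linorder} qmat"
  assumes "qhermitian H"
  shows "cdet \<beta> i (repl_col H i c) = (\<Sum>p\<in>UNIV. cdet \<beta> i (repl_col H i (axis p 1)) * c $ p)"
proof -
  have "(\<Sum>p\<in>UNIV. cdet \<beta> i (repl_col H i (axis p 1)) * c $ p) =
    (\<Sum>\<sigma> | \<sigma> permutes \<beta>. \<Sum>p\<in>UNIV. (csgn \<beta> \<sigma> * real_cycles_off H \<beta> i \<sigma>) *\<^sub>R (open_prod H \<sigma> i * axis p 1 $ inv \<sigma> i) * c $ p)"
    unfolding cdet_repl_col[OF assms] sum_distrib_right by (rule sum.swap)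
  also have "\<dots> = cdet \<beta> i (repl_col H i c)"
    unfolding cdet_repl_col[OF assms]
  proof (rule sum.cong[OF refl])
    fix \<sigma>
    have "(\<Sum>p\<in>UNIV. (csgn \<beta> \<sigma> * real_cycles_off H \<beta> i \<sigma>) *\<^sub>R (open_prod H \<sigma> i * axis p 1 $ inv \<sigma> i) * c $ p) =
      (\<Sum>p\<in>UNIV. if p = inv \<sigma> i then (csgn \<beta> \<sigma> * real_cycles_off H \<beta> i \<sigma>) *\<^sub>R (open_prod H \<sigma> i * c $ p) else 0)"
      by (rule sum.cong) (auto simp: axis_def)
    then show "(\<Sum>p\<in>UNIV. (csgn \<beta> \<sigma> * real_cycles_off H \<beta> i \<sigma>) *\<^sub>R (open_prod H \<sigma> i * axis p 1 $ inv \<sigma> i) * c $ p) =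
      (csgn \<beta> \<sigma> * real_cycles_off H \<beta> i \<sigma>) *\<^sub>R (open_prod H \<sigma> i * c $ inv \<sigma> i)" by simp
  qed
  finally show ?thesis by simp
qed

lemma
  fixes \<tau> :: "'n::{finite,linorder} \<Rightarrow> 'n"
  assumes "\<tau> permutes \<beta>" and "p \<notin> \<beta>"
  shows orbit_outside: "orbit \<tau> p = {p}"
    and orbit_inside: "q \<in> \<beta> \<Longrightarrow> p \<notin> orbit \<tau> q"
    and csgn_insert: "csgn (insert p \<beta>) \<tau> = csgn \<beta> \<tau>"
proof -
  show o: "orbit \<tau> p = {p}" using assms by (simp add: orbit_eq_singleton_iff permutes_def)
  show q: "p \<notin> orbit \<tau> q" if "q \<in> \<beta>" for q using permutes_orbit_subset[OF assms(1) that] assms(2) by auto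
  have "{p} \<notin> orbit \<tau> ` \<beta>" using q by blast
  then show "csgn (insert p \<beta>) \<tau> = csgn \<beta> \<tau>"
    using assms(2) by (simp add: csgn_def o)
qed

text \<open>The unit column kills all permutations that move \<open>i\<close>. For the others
  \<open>i\<close> is a fixed point, which adds one label and one cycle, so the sign is that on
  \<open>\<beta>\<close>.\<close>

lemma cdet_insert_axis_self:
  fixes H :: "'n::{finite,linorder} qmat"
  assumes "qhermitian H" and "i \<notin> \<beta>"
  shows "cdet (insert i \<beta>) i (repl_col H i (axis i 1)) = of_real (minor H \<beta>)"
proof -
  have "cdet (insert i \<beta>) i (repl_col H i (axis i 1)) =
    (\<Sum>\<sigma> | \<sigma> permutes \<beta>. (csgn (insert i \<beta>) \<sigma> * real_cycles_off H (insert i \<beta>) i \<sigma>) *\<^sub>R (open_prod H \<sigma> i * axis i 1 $ inv \<sigma> i))"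
    unfolding cdet_repl_col[OF assms(1)]
  proof (rule sum.mono_neutral_right)
    show "{\<sigma>. \<sigma> permutes \<beta>} \<subseteq> {\<sigma>. \<sigma> permutes insert i \<beta>}"
      using permutes_subset by blast
    have "inv \<sigma> i \<noteq> i" if "\<sigma> permutes insert i \<beta>" "\<not> \<sigma> permutes \<beta>" for \<sigma>
    proof
      assume "inv \<sigma> i = i"
      then have "\<sigma> i = i" using permutes_inverses(1)[OF that(1), of i] by simp
      then have "\<sigma> permutes \<beta>" using permutes_superset[OF that(1), of \<beta>] by auto
      then show False using that by simp
    qed
    then show "\<forall>\<sigma>\<in>{\<sigma>. \<sigma> permutes insert i \<beta>} - {\<sigma>. \<sigma> permutes \<beta>}.
      (csgn (insert i \<beta>) \<sigma> * real_cycles_off H (insert i \<beta>) i \<sigma>) *\<^sub>R (open_prod H \<sigma> i * axis i 1 $ inv \<sigma> i) = 0"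
      by (auto simp: axis_def)
  qed (simp add: finite_permutations)
  also have "\<dots> = (\<Sum>\<sigma> | \<sigma> permutes \<beta>. of_real (csgn \<beta> \<sigma> * real_cycles H \<beta> \<sigma>))"
  proof (rule sum.cong[OF refl])
    fix \<sigma> assume "\<sigma> \<in> {\<sigma>. \<sigma> permutes \<beta>}"
    then have S: "\<sigma> permutes \<beta>" by simp
    have o: "orbit \<sigma> i = {i}" by (rule orbit_outside[OF S assms(2)])
    have "{q \<in> insert i \<beta>. i \<notin> orbit \<sigma> q \<and> q = Min (orbit \<sigma> q)} = {q \<in> \<beta>. q = Min (orbit \<sigma> q)}"
      using orbit_inside[OF S assms(2)] o by auto
    then have 1: "real_cycles_off H (insert i \<beta>) i \<sigma> = real_cycles H \<beta> \<sigma>"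
      by (simp add: real_cycles_off_def real_cycles_def)
    have 2: "open_prod H \<sigma> i = 1" by (simp add: open_prod_def o)
    have 3: "inv \<sigma> i = i" using permutes_inv[OF S] assms(2) by (simp add: permutes_def)
    show "(csgn (insert i \<beta>) \<sigma> * real_cycles_off H (insert i \<beta>) i \<sigma>) *\<^sub>R (open_prod H \<sigma> i * axis i 1 $ inv \<sigma> i) =
      of_real (csgn \<beta> \<sigma> * real_cycles H \<beta> \<sigma>)"
      unfolding 1 2 3 csgn_insert[OF S assms(2)] by (simp add: of_real_def axis_def)
  qed
  finally show ?thesis by (simp add: minor_def)
qed

text \<open>
  The permutations of \<open>insert p \<beta>\<close> with \<open>p \<mapsto> i\<close> arise from those of \<open>\<beta>\<close> by inserting \<open>p\<close> right
  before \<open>i\<close>.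
\<close>

lemma cdet_insert_axis_other:
  fixes H :: "'n::{finite,linorder} qmat"
  assumes "qhermitian H" and "i \<in> \<beta>" "p \<notin> \<beta>"
  shows "cdet (insert p \<beta>) i (repl_col H i (axis p 1)) = - cdet \<beta> i (repl_col H i (column p H))"
proof -
  let ?B = "insert p \<beta>"
  let ?f = "\<lambda>\<sigma>. (csgn ?B \<sigma> * real_cycles_off H ?B i \<sigma>) *\<^sub>R (open_prod H \<sigma> i * axis p 1 $ inv \<sigma> i)"
  let ?g = "\<lambda>\<tau>. - ((csgn \<beta> \<tau> * real_cycles_off H \<beta> i \<tau>) *\<^sub>R (open_prod H \<tau> i * H $ inv \<tau> i $ p))"
  have "(\<Sum>\<sigma> | \<sigma> permutes ?B. ?f \<sigma>) = (\<Sum>\<sigma> | \<sigma> permutes ?B \<and> \<sigma> p = i. ?f \<sigma>)"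
  proof (rule sum.mono_neutral_right)
    have "inv \<sigma> i \<noteq> p" if "\<sigma> permutes ?B" "\<sigma> p \<noteq> i" for \<sigma>
      using that permutes_inverses(1)[OF that(1), of i] by auto
    then show "\<forall>\<sigma>\<in>{\<sigma>. \<sigma> permutes ?B} - {\<sigma>. \<sigma> permutes ?B \<and> \<sigma> p = i}. ?f \<sigma> = 0"
      by (auto simp: axis_def)
  qed (auto simp: finite_permutations)
  also have "\<dots> = (\<Sum>\<tau> | \<tau> permutes \<beta>. ?g \<tau>)"
  proof (rule sum.reindex_bij_witness[of _ "post_swap i p" "post_swap i p"])
    fix \<sigma> assume "\<sigma> \<in> {\<sigma>. \<sigma> permutes ?B \<and> \<sigma> p = i}"
    then have S: "\<sigma> permutes ?B" "\<sigma> p = i" by auto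
    let ?t = "post_swap i p \<sigma>"
    have tB: "?t permutes ?B" using S assms by (intro permutes_post_swap) auto
    moreover have "?t p = p" using S by (simp add: post_swap_def)
    ultimately have T: "?t permutes \<beta>" using permutes_superset[of ?t ?B \<beta>] by auto
    then show "?t \<in> {\<tau>. \<tau> permutes \<beta>}" by simp
    show pp: "post_swap i p ?t = \<sigma>" by (rule post_swap_post_swap)
    have P: "permutation ?t" by (rule permutation_if_permutes[OF T])
    have op: "orbit ?t p = {p}" by (rule orbit_outside[OF T assms(3)])
    have oi: "p \<notin> orbit ?t i" by (rule orbit_inside[OF T assms(3,2)])
    have 1: "csgn ?B \<sigma> = - csgn \<beta> ?t"
      using csgn_post_swap[OF P oi, of ?B] assms(2) csgn_insert[OF T assms(3)] by (simp add: pp)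
    have 2: "inv \<sigma> i = p"
      using inv_post_swap[OF P, of i p] permutes_inv[OF T] assms(3) by (simp add: pp permutes_def)
    \<comment> \<open>\<open>p\<close> is a fixed point of \<open>?t\<close>, so its open product is
      empty; the remaining entry is the one that column \<open>p\<close> of \<open>H\<close>
      contributes on \<open>\<beta>\<close>.\<close>
    have 3: "open_prod H \<sigma> i = open_prod H ?t i * H $ inv ?t i $ p"
      using open_prod_post_swap[OF P oi, of H] by (simp add: pp open_prod_def[of H ?t p] op)
    have "{q \<in> ?B. i \<notin> orbit ?t q \<and> p \<notin> orbit ?t q \<and> q = Min (orbit ?t q)} =
        {q \<in> \<beta>. i \<notin> orbit ?t q \<and> q = Min (orbit ?t q)}"
      using op orbit_inside[OF T assms(3)] by auto
    then have 4: "real_cycles_off H ?B i \<sigma> = real_cycles_off H \<beta> i ?t"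
      using real_cycles_off_post_swap[OF P oi, of H ?B] by (simp add: pp real_cycles_off_def[of H \<beta>])
    show "?g ?t = ?f \<sigma>" unfolding 1 2 3 4 by (simp add: axis_def)
  next
    fix \<tau> assume "\<tau> \<in> {\<tau>. \<tau> permutes \<beta>}"
    then have T: "\<tau> permutes \<beta>" by simp
    then have "\<tau> permutes ?B" using permutes_subset by blast
    then have "post_swap i p \<tau> permutes ?B" using assms by (intro permutes_post_swap) auto
    moreover have "\<tau> p = p" using T assms(3) by (simp add: permutes_def)
    ultimately show "post_swap i p \<tau> \<in> {\<sigma>. \<sigma> permutes ?B \<and> \<sigma> p = i}"
      using assms by (auto simp: post_swap_def)
    show "post_swap i p (post_swap i p \<tau>) = \<tau>" by (rule post_swap_post_swap)
  qed
  finally show ?thesis by (simp add: cdet_repl_col[OF assms(1)] column_def sum_negf)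
qed

lemma cdet_axis_outside:
  fixes H :: "'n::{finite,linorder} qmat"
  assumes "qhermitian H" and "i \<in> \<beta>" "p \<notin> \<beta>"
  shows "cdet \<beta> i (repl_col H i (axis p 1)) = 0"
  unfolding cdet_repl_col[OF assms(1)]
proof (rule sum.neutral, clarify)
  fix \<sigma> assume "\<sigma> permutes \<beta>"
  then have "inv \<sigma> i \<in> \<beta>" using assms(2) permutes_inv permutes_in_image by metis
  then have "inv \<sigma> i \<noteq> p" using assms(3) by auto
  then show "(csgn \<beta> \<sigma> * real_cycles_off H \<beta> i \<sigma>) *\<^sub>R (open_prod H \<sigma> i * axis p 1 $ inv \<sigma> i) = 0"
    by (simp add: axis_def)
qed

text \<open>Numerators for unit columns. As \<open>cdet\<close> is right linear in the replaced
  column, every other column numerator is an entry of a product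
  \<open>coadj m H ** B\<close>.\<close>

definition coadj :: "nat \<Rightarrow> 'n::{finite,linorder} qmat \<Rightarrow> 'n qmat" where
  "coadj m H = (\<chi> i p. \<Sum>\<beta>\<in>ksets_at m i. cdet \<beta> i (repl_col H i (axis p 1)))"

definition minor_sum :: "nat \<Rightarrow> 'n::{finite,linorder} qmat \<Rightarrow> real" where
  "minor_sum m H = (\<Sum>\<beta>\<in>ksets m. minor H \<beta>)"

lemma coadj_mult_column:
  fixes H :: "'n::{finite,linorder} qmat"
  assumes "qhermitian H"
  shows "(\<Sum>\<beta>\<in>ksets_at m i. cdet \<beta> i (repl_col H i (column j B))) = (coadj m H ** B) $ i $ j"
proof -
  have "(\<Sum>\<beta>\<in>ksets_at m i. cdet \<beta> i (repl_col H i (column j B))) =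
    (\<Sum>\<beta>\<in>ksets_at m i. \<Sum>p\<in>UNIV. cdet \<beta> i (repl_col H i (axis p 1)) * B $ p $ j)"
    by (subst cdet_repl_col_linear[OF assms]) (simp add: column_def)
  also have "\<dots> = (\<Sum>p\<in>UNIV. (\<Sum>\<beta>\<in>ksets_at m i. cdet \<beta> i (repl_col H i (axis p 1))) * B $ p $ j)"
    by (subst sum.swap) (simp add: sum_distrib_right)
  finally show ?thesis by (simp add: coadj_def matrix_matrix_mult_def)
qed

lemma sum_ksets_insert:
  fixes i :: "'n::finite"
  shows "(\<Sum>\<beta>\<in>ksets_at (Suc m) i. f \<beta>) = (\<Sum>\<beta> | card \<beta> = m \<and> i \<notin> \<beta>. f (insert i \<beta>))"
proof (rule sum.reindex_bij_witness[of _ "insert i" "\<lambda>\<beta>. \<beta> - {i}"])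
  fix \<beta> assume "\<beta> \<in> ksets_at (Suc m) i"
  then have "card \<beta> = Suc m" "i \<in> \<beta>" by (simp_all add: ksets_at_def)
  then show "\<beta> - {i} \<in> {\<beta>. card \<beta> = m \<and> i \<notin> \<beta>}" "insert i (\<beta> - {i}) = \<beta>"
    "f (insert i (\<beta> - {i})) = f \<beta>"
    by (auto simp: insert_absorb)
next
  fix \<beta> :: "'n set" assume "\<beta> \<in> {\<beta>. card \<beta> = m \<and> i \<notin> \<beta>}"
  then show "insert i \<beta> - {i} = \<beta>" "insert i \<beta> \<in> ksets_at (Suc m) i"
    by (auto simp: ksets_at_def card_insert_if)
qed

lemma coadj_mult_diagonal:
  fixes H :: "'n::{finite,linorder} qmat"
  assumes "qhermitian H"
  shows "(coadj m H ** H) $ i $ i = of_real (\<Sum>\<beta>\<in>ksets_at m i. minor H \<beta>)"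
  unfolding coadj_mult_column[OF assms, symmetric] repl_col_column of_real_sum
  by (rule sum.cong) (simp_all add: cdet_hermitian[OF assms] ksets_at_def)

text \<open>
  This is the Faddeev--LeVerrier recursion: \<open>coadj m H\<close> is a coefficient of the adjugate of
  \<open>t + H\<close>, and \<open>minor_sum m H\<close> is one of its determinant.
\<close>

lemma coadj_Suc:
  fixes H :: "'n::{finite,linorder} qmat"
  assumes "qhermitian H"
  shows "coadj (Suc m) H + coadj m H ** H = minor_sum m H *\<^sub>R mat 1"
proof -
  have "(coadj (Suc m) H + coadj m H ** H) $ i $ p = (minor_sum m H *\<^sub>R mat 1) $ i $ p" for i p
  proof (cases "p = i")
    case True
    have "coadj (Suc m) H $ i $ i = of_real (\<Sum>\<beta> | card \<beta> = m \<and> i \<notin> \<beta>. minor H \<beta>)"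
      by (simp add: coadj_def sum_ksets_insert cdet_insert_axis_self[OF assms])
    then have "(coadj (Suc m) H + coadj m H ** H) $ i $ i =
      of_real ((\<Sum>\<beta> | card \<beta> = m \<and> i \<notin> \<beta>. minor H \<beta>) + (\<Sum>\<beta>\<in>ksets_at m i. minor H \<beta>))"
      by (simp add: coadj_mult_diagonal[OF assms])
    also have "(\<Sum>\<beta> | card \<beta> = m \<and> i \<notin> \<beta>. minor H \<beta>) + (\<Sum>\<beta>\<in>ksets_at m i. minor H \<beta>) = minor_sum m H"
      unfolding minor_sum_def ksets_def ksets_at_def
      by (subst sum.union_disjoint[symmetric]) (auto intro!: sum.cong)
    finally show ?thesis using True by (simp add: mat_def of_real_def)
  next
    case False
    \<comment> \<open>Sets without \<open>p\<close> contribute nothing; deleting \<open>p\<close>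
      from the others gives sets of size \<open>m\<close>, with column \<open>p\<close> of
      \<open>H\<close> and a minus sign.\<close>
    have "coadj (Suc m) H $ i $ p = (\<Sum>\<beta> | card \<beta> = Suc m \<and> i \<in> \<beta> \<and> p \<in> \<beta>. cdet \<beta> i (repl_col H i (axis p 1)))"
      unfolding coadj_def vec_lambda_beta
      by (rule sum.mono_neutral_right) (auto simp: ksets_at_def cdet_axis_outside[OF assms])
    also have "\<dots> = (\<Sum>\<beta>\<in>ksets_at (Suc m) p. if i \<in> \<beta> then cdet \<beta> i (repl_col H i (axis p 1)) else 0)"
      by (rule sum.mono_neutral_cong_left) (auto simp: ksets_at_def)
    also have "\<dots> = (\<Sum>\<beta> | card \<beta> = m \<and> p \<notin> \<beta>. if i \<in> \<beta> then - cdet \<beta> i (repl_col H i (column p H)) else 0)"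
      unfolding sum_ksets_insert by (rule sum.cong) (use False in \<open>auto simp: cdet_insert_axis_other[OF assms]\<close>)
    \<comment> \<open>The sets obtained so far avoid \<open>p\<close>. Those containing both
      \<open>i\<close> and \<open>p\<close> may be added, because a foreign column with label in the
      set gives zero.\<close>
    also have "\<dots> = (\<Sum>\<beta>\<in>ksets_at m i. - cdet \<beta> i (repl_col H i (column p H)))"
      by (rule sum.mono_neutral_cong) (use False in \<open>auto simp: ksets_at_def cdet_repl_col_column[OF assms]\<close>)
    also have "\<dots> = - (coadj m H ** H) $ i $ p"
      by (simp add: coadj_mult_column[OF assms] sum_negf)
    finally show ?thesis using False by (simp add: mat_def)
  qed
  then show ?thesis by (simp add: vec_eq_iff)
qed

lemma coadj_0 [simp]: "coadj 0 H = 0"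
proof -
  have "ksets_at 0 i = {}" for i :: 'a by (auto simp: ksets_at_def)
  then show ?thesis by (simp add: coadj_def vec_eq_iff)
qed

lemma coadj_Suc_card [simp]: "coadj (Suc CARD('n)) (H :: 'n::{finite,linorder} qmat) = 0"
proof -
  have "card \<beta> \<noteq> Suc CARD('n)" for \<beta> :: "'n set"
    using card_mono[of UNIV \<beta>] by auto
  then show ?thesis by (simp add: coadj_def ksets_at_def vec_eq_iff)
qed

lemma minor_sum_0 [simp]: "minor_sum 0 H = 1"
  by (simp add: minor_sum_def minor_def ksets_def real_cycles_def csgn_def)

text \<open>In the sum over \<open>inv \<sigma>\<close> all cycles run backwards. Conjugation
  accounts for this and also reverses the order of the cycles, which is the difference between the
  two determinants; row results thus follow from column results.\<close>

lemma rdet_eq_cdet: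
  fixes M :: "'n::{finite,linorder} qmat"
  shows "rdet \<alpha> i M = qcnj (cdet \<alpha> i (qadj M))"
proof -
  have "rdet \<alpha> i M = (\<Sum>\<sigma> | \<sigma> permutes \<alpha>. cycle_sign \<alpha> (inv \<sigma>) *
     (cycle_prod M (inv \<sigma>) i * prod_list (map (cycle_prod M (inv \<sigma>)) (cycle_mins \<alpha> i (inv \<sigma>)))))"
    unfolding rdet_def
    by (rule sum.reindex_bij_witness[of _ inv inv]) (auto simp: permutes_inv permutes_inv_inv)
  also have "\<dots> = qcnj (cdet \<alpha> i (qadj M))"
    unfolding cdet_def qcnj_sum
  proof (rule sum.cong[OF refl])
    fix \<sigma> assume "\<sigma> \<in> {\<sigma>. \<sigma> permutes \<alpha>}"
    then have P: "permutation \<sigma>" using permutation_if_permutes by auto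
    have 1: "cycle_mins \<alpha> i (inv \<sigma>) = cycle_mins \<alpha> i \<sigma>" "csgn \<alpha> (inv \<sigma>) = csgn \<alpha> \<sigma>"
      by (intro cycle_mins_cong csgn_cong orbit_inv_eq[OF P])+
    have 2: "qcnj (prod_list (map (cycle_prod (qadj M) \<sigma>) (rev xs))) = prod_list (map (cycle_prod M (inv \<sigma>)) xs)" for xs
      by (induction xs) (simp_all add: cycle_prod_inv[OF P])
    show "cycle_sign \<alpha> (inv \<sigma>) *
      (cycle_prod M (inv \<sigma>) i * prod_list (map (cycle_prod M (inv \<sigma>)) (cycle_mins \<alpha> i (inv \<sigma>)))) =
      qcnj (cycle_sign \<alpha> \<sigma> *
        (prod_list (map (cycle_prod (qadj M) \<sigma>) (rev (cycle_mins \<alpha> i \<sigma>))) * cycle_prod (qadj M) \<sigma> i))"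
      unfolding cycle_sign_eq 1
      by (simp add: 2 cycle_prod_inv[OF P] scaleR_conv_of_real[symmetric])
  qed
  finally show ?thesis .
qed

text \<open>On the empty set the condition defining \<open>hdet\<close> holds for every real number,
  hence the hypothesis \<open>\<beta> \<noteq> {}\<close> here and \<open>m > 0\<close> for the
  sums.\<close>

lemma hdet_hermitian:
  fixes H :: "'n::{finite,linorder} qmat"
  assumes "qhermitian H" and "\<beta> \<noteq> {}"
  shows "hdet \<beta> H = minor H \<beta>"
proof -
  have adj: "qadj H = H" using assms(1) by (simp add: qhermitian_def)
  show ?thesis
    unfolding hdet_def
    by (rule the_equality) (use assms(2) in \<open>auto simp: rdet_eq_cdet adj cdet_hermitian[OF assms(1)]\<close>)
qed

lemma sum_hdet_hermitian:
  fixes H :: "'n::{finite,linorder} qmat"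
  assumes "qhermitian H" and "m > 0"
  shows "(\<Sum>\<beta>\<in>ksets m. hdet \<beta> H) = minor_sum m H"
  unfolding minor_sum_def
  by (rule sum.cong) (use assms in \<open>auto simp: ksets_def intro!: hdet_hermitian\<close>)

lemma coadj_mult_row:
  fixes H :: "'n::{finite,linorder} qmat"
  assumes "qhermitian H"
  shows "(\<Sum>\<alpha>\<in>ksets_at m j. rdet \<alpha> j (repl_row H j (row i B))) = (B ** qadj (coadj m H)) $ i $ j"
proof -
  have "qadj (repl_row H j b) = repl_col H j (\<chi> p. qcnj (b $ p))" for b
    using assms by (auto simp: vec_eq_iff qhermitian_def qadj_def repl_row_def repl_col_def)
  moreover have "(\<chi> p. qcnj (row i B $ p)) = column i (qadj B)"
    by (simp add: vec_eq_iff row_def column_def qadj_def)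
  ultimately have "(\<Sum>\<alpha>\<in>ksets_at m j. rdet \<alpha> j (repl_row H j (row i B))) = qcnj ((coadj m H ** qadj B) $ j $ i)"
    by (simp add: rdet_eq_cdet qcnj_sum[symmetric] coadj_mult_column[OF assms])
  also have "\<dots> = (B ** qadj (coadj m H)) $ i $ j"
    by (simp add: matrix_matrix_mult_def qadj_def qcnj_sum)
  finally show ?thesis .
qed

section \<open>Rank and trace\<close>

lemma qadj_simps [simp]:
  "qadj (qadj A) = A" "qadj (A - B) = qadj A - qadj B" "qadj (r *\<^sub>R A) = r *\<^sub>R qadj A"
  "qadj 0 = 0" "qadj (mat 1) = mat 1"
  by (simp_all add: qadj_def vec_eq_iff mat_def)

lemma qadj_mult: "qadj (A ** B) = qadj B ** qadj A"
  by (simp add: qadj_def matrix_matrix_mult_def qcnj_sum)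

lemma matrix_diff_ldistrib: "A ** (B - C) = A ** B - A ** (C :: 'a::ring_1^'n^'m)"
  by (simp add: matrix_matrix_mult_def vec_eq_iff right_diff_distrib sum_subtractf)

lemma matrix_diff_rdistrib: "(A - B) ** C = A ** C - B ** (C :: 'a::ring_1^'n^'m)"
  by (simp add: matrix_matrix_mult_def vec_eq_iff left_diff_distrib sum_subtractf)

lemma matrix_mul_zero [simp]: "A ** 0 = (0 :: 'a::ring_1^'n^'m)" "0 ** B = (0 :: 'a::ring_1^'n^'m)"
  by (simp_all add: matrix_matrix_mult_def vec_eq_iff)

lemma matrix_scaleR_left: "(r *\<^sub>R A) ** B = r *\<^sub>R (A ** B)" for A :: "'a::real_algebra_1^'n^'m"
  by (simp add: scalar_matrix_assoc)

lemma matrix_scaleR_right: "A ** (r *\<^sub>R B) = r *\<^sub>R (A ** B)" for B :: "'a::real_algebra_1^'n^'m"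
  by (simp add: matrix_scalar_ac scalar_matrix_assoc)

definition rtr :: "quat^'n^'n \<Rightarrow> real" where
  "rtr A = (\<Sum>i\<in>UNIV. qre (A $ i $ i))"

lemma rtr_mult_commute: "rtr (A ** B) = rtr (B ** A)"
  unfolding rtr_def matrix_matrix_mult_def vec_lambda_beta qre_sum
  by (subst sum.swap) (simp add: qre_mult_commute)

lemma rtr_diff: "rtr (A - B) = rtr A - rtr B"
  by (simp add: rtr_def sum_subtractf)

lemma rtr_scaleR: "rtr (r *\<^sub>R A) = r * rtr A"
  by (simp add: rtr_def sum_distrib_left)

lemma rtr_qadj: "rtr (qadj A) = rtr A"
  by (simp add: rtr_def qadj_def)

text \<open>The squared Frobenius norm of \<open>A\<close>; its definiteness yields the
  cancellations of adjoint factors below.\<close>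

lemma rtr_mult_qadj: "rtr (A ** qadj A) = (\<Sum>i\<in>UNIV. \<Sum>j\<in>UNIV. qre (A $ i $ j * qcnj (A $ i $ j)))"
  by (simp add: rtr_def matrix_matrix_mult_def qadj_def qre_sum)

lemma rtr_mult_qadj_nonneg: "rtr (A ** qadj A) \<ge> 0"
  unfolding rtr_mult_qadj by (intro sum_nonneg qre_mult_qcnj_nonneg)

lemma rtr_mult_qadj_eq_0:
  assumes "rtr (A ** qadj A) = 0"
  shows "A = 0"
proof -
  have "\<forall>i. (\<Sum>j\<in>UNIV. qre (A $ i $ j * qcnj (A $ i $ j))) = 0"
    using assms unfolding rtr_mult_qadj
    by (subst (asm) sum_nonneg_eq_0_iff) (auto intro!: sum_nonneg simp: qre_mult_qcnj_nonneg)
  then have "\<forall>i j. qre (A $ i $ j * qcnj (A $ i $ j)) = 0"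
    by (subst (asm) sum_nonneg_eq_0_iff) (auto simp: qre_mult_qcnj_nonneg)
  then show ?thesis by (simp add: qre_mult_qcnj_eq_0_iff vec_eq_iff)
qed

lemma mult_qadj_eq_0: "A ** qadj A = 0 \<Longrightarrow> A = 0"
  by (rule rtr_mult_qadj_eq_0) (simp add: rtr_def)

section \<open>Spans and bases of right vector spaces\<close>

lemma right_scale_simps:
  "right_scale v (c + d) = right_scale v c + right_scale v d"
  "right_scale (v + w) c = right_scale v c + right_scale w c"
  "right_scale (right_scale v c) d = right_scale v (c * d)"
  "right_scale v 0 = 0" "right_scale 0 c = 0" "right_scale v 1 = v" "right_scale v (- c) = - right_scale v c"
  by (simp_all add: right_scale_def vec_eq_iff distrib_left distrib_right mult.assoc)

lemma right_scale_sum_left: "right_scale (sum f S) c = (\<Sum>x\<in>S. right_scale (f x) c)"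
  by (induction S rule: infinite_finite_induct) (simp_all add: right_scale_simps)

lemma right_scale_sum_right: "right_scale v (sum f S) = (\<Sum>x\<in>S. right_scale v (f x))"
  by (induction S rule: infinite_finite_induct) (simp_all add: right_scale_simps)

lemma matrix_vector_mult_right_scale: "A *v right_scale v c = right_scale (A *v v) c"
  by (simp add: right_scale_def vec_eq_iff matrix_vector_mult_def sum_distrib_right mult.assoc)

lemma matrix_vector_mult_sum: "A *v sum f S = (\<Sum>x\<in>S. A *v (f x :: quat^'n))"
  by (induction S rule: infinite_finite_induct) (simp_all add: matrix_vector_right_distrib)

lemma right_span_finite:
  assumes "finite T"
  shows "right_span T = {x. \<exists>c. x = (\<Sum>v\<in>T. right_scale v (c v))}"
proof (intro set_eqI iffI)
  fix x assume "x \<in> right_span T"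
  then obtain F c where F: "finite F" "F \<subseteq> T" "x = (\<Sum>v\<in>F. right_scale v (c v))"
    by (auto simp: right_span_def)
  have "x = (\<Sum>v\<in>T. right_scale v (if v \<in> F then c v else 0))"
    unfolding F(3) by (rule sum.mono_neutral_cong_left) (use F assms in \<open>auto simp: right_scale_simps\<close>)
  then show "x \<in> {x. \<exists>c. x = (\<Sum>v\<in>T. right_scale v (c v))}"
    by (auto intro!: exI[of _ "\<lambda>v. if v \<in> F then c v else 0"])
qed (use assms in \<open>auto simp: right_span_def\<close>)

lemma right_span_superset: "v \<in> S \<Longrightarrow> v \<in> right_span S"
  unfolding right_span_def by (auto intro!: exI[of _ "{v}"] exI[of _ "\<lambda>_. 1"] simp: right_scale_simps)

lemma right_span_minimal:
  assumes "finite T" and "S \<subseteq> right_span T"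
  shows "right_span S \<subseteq> right_span T"
proof
  fix x assume "x \<in> right_span S"
  then obtain F c where F: "finite F" "F \<subseteq> S" "x = (\<Sum>v\<in>F. right_scale v (c v))"
    by (auto simp: right_span_def)
  have "\<forall>v\<in>F. \<exists>d. v = (\<Sum>w\<in>T. right_scale w (d w))"
    using F assms(2) unfolding right_span_finite[OF assms(1)] by blast
  then obtain d where d: "\<And>v. v \<in> F \<Longrightarrow> v = (\<Sum>w\<in>T. right_scale w (d v w))"
    by metis
  have "x = (\<Sum>v\<in>F. right_scale (\<Sum>w\<in>T. right_scale w (d v w)) (c v))"
    unfolding F(3) by (rule sum.cong) (use d in \<open>auto\<close>)
  also have "\<dots> = (\<Sum>w\<in>T. right_scale w (\<Sum>v\<in>F. d v w * c v))"
    unfolding right_scale_sum_left right_scale_sum_right right_scale_simps by (rule sum.swap)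
  finally show "x \<in> right_span T" unfolding right_span_finite[OF assms(1)] by (intro CollectI exI)
qed

text \<open>A spanning subset of least cardinality is independent: in a relation with nonzero
  coefficient at \<open>w\<close> one can divide by it on the right and drop
  \<open>w\<close>.\<close>

lemma right_basis_exists:
  assumes "finite (S :: (quat^'m) set)"
  shows "\<exists>B. right_independent B \<and> right_span B = right_span S"
proof -
  have "\<exists>F. (F \<subseteq> S \<and> right_span F = right_span S) \<and>
    (\<forall>G. G \<subseteq> S \<and> right_span G = right_span S \<longrightarrow> card F \<le> card G)"
    by (rule ex_has_least_nat[of _ S]) simp
  then obtain F where F: "F \<subseteq> S" "right_span F = right_span S"
    and least: "\<And>G. G \<subseteq> S \<Longrightarrow> right_span G = right_span S \<Longrightarrow> card F \<le> card G"
    by auto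
  have fin: "finite F" using F assms finite_subset by blast
  have "right_independent F"
    unfolding right_independent_def
  proof (intro allI impI ballI, rule ccontr)
    fix G c w
    assume G: "finite G \<and> G \<subseteq> F \<and> (\<Sum>v\<in>G. right_scale v (c v)) = 0" and w: "w \<in> G" and c: "c w \<noteq> 0"
    have "w \<in> right_span (F - {w})"
    proof -
      have "right_scale w (c w) + (\<Sum>v\<in>G - {w}. right_scale v (c v)) = 0"
        using G w sum.remove[of G w "\<lambda>v. right_scale v (c v)"] by simp
      then have "right_scale w (c w) = - (\<Sum>v\<in>G - {w}. right_scale v (c v))"
        by (simp add: eq_neg_iff_add_eq_0)
      also have "\<dots> = (\<Sum>v\<in>G - {w}. right_scale v (- c v))" by (simp add: right_scale_simps sum_negf)
      finally have "right_scale (right_scale w (c w)) (inverse (c w)) =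
        (\<Sum>v\<in>G - {w}. right_scale v (- c v * inverse (c w)))"
        by (simp only: right_scale_sum_left right_scale_simps(3))
      then have "w = (\<Sum>v\<in>G - {w}. right_scale v (- c v * inverse (c w)))"
        using c by (simp add: right_scale_simps)
      moreover have "finite (G - {w})" "G - {w} \<subseteq> F - {w}" using G by auto
      ultimately show "w \<in> right_span (F - {w})"
        unfolding right_span_def by (intro CollectI exI conjI)
    qed
    then have "F \<subseteq> right_span (F - {w})" using right_span_superset[of _ "F - {w}"] by fast
    then have "right_span F \<subseteq> right_span (F - {w})" by (intro right_span_minimal) (use fin in auto)
    moreover have "right_span (F - {w}) \<subseteq> right_span F"
      by (rule right_span_minimal[OF fin]) (auto intro: right_span_superset)
    ultimately have "card F \<le> card (F - {w})" using F by (intro least) auto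
    moreover have "card (F - {w}) < card F" using w G fin by (intro card_Diff1_less) auto
    ultimately show False by simp
  qed
  with F show ?thesis by blast
qed

lemma finite_columns: "finite (columns (A :: 'a^'n^'m))"
  by (simp add: columns_def full_SetCompr_eq)

text \<open>
  A factorization \<open>A ** Y = B ** C\<close> with the columns of \<open>B\<close> a basis satisfies \<open>C ** B = 1\<close>, so the
  real trace of this idempotent counts the basis.
\<close>

lemma card_basis_eq_rtr:
  fixes A :: "quat^'n^'m"
  assumes inv: "A ** Y ** A = A"
    and indep: "right_independent B" and span: "right_span B = right_span (columns A)"
  shows "real (card B) = rtr (A ** Y)"
proof -
  let ?P = "A ** Y"
  have fix_col: "?P *v column j A = column j A" for j
    using arg_cong[OF inv, of "column j"]
    by (simp add: column_def matrix_matrix_mult_def matrix_vector_mult_def vec_eq_iff)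
  have fix_B: "?P *v v = v" if "v \<in> B" for v
  proof -
    have "v \<in> right_span (columns A)" using that span right_span_superset by blast
    then obtain F c where F: "F \<subseteq> columns A" "v = (\<Sum>u\<in>F. right_scale u (c u))"
      by (auto simp: right_span_def)
    show ?thesis
      unfolding F(2) matrix_vector_mult_sum matrix_vector_mult_right_scale
      by (rule sum.cong) (use F(1) fix_col in \<open>auto simp: columns_def\<close>)
  qed
  have "\<forall>j. \<exists>F c. finite F \<and> F \<subseteq> B \<and> column j A = (\<Sum>v\<in>F. right_scale v (c v))"
  proof
    fix j
    have "column j A \<in> right_span B"
      unfolding span by (rule right_span_superset) (auto simp: columns_def)
    then show "\<exists>F c. finite F \<and> F \<subseteq> B \<and> column j A = (\<Sum>v\<in>F. right_scale v (c v))"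
      by (simp add: right_span_def)
  qed
  then obtain F c where Fc: "\<And>j. finite (F j)" "\<And>j. F j \<subseteq> B"
    "\<And>j. column j A = (\<Sum>v\<in>F j. right_scale v (c j v))" by metis
  \<comment> \<open>\<open>B\<close> is not known to be finite. \<open>G\<close> collects the basis
    vectors that occur in the columns of \<open>A\<close>; it turns out to be all of
    \<open>B\<close>.\<close>
  define G where "G = (\<Union>j. F j)"
  have G: "finite G" "G \<subseteq> B" using Fc(1,2) by (auto simp: G_def)
  \<comment> \<open>Coordinates of the columns of \<open>A\<close>, times \<open>Y\<close>: the
    matrix \<open>C\<close> with \<open>A ** Y = B ** C\<close>.\<close>
  define d where "d v y = (\<Sum>j\<in>UNIV. (if v \<in> F j then c j v else 0) * Y $ j $ y)" for v y
  have A: "A $ x $ j = (\<Sum>v\<in>G. v $ x * (if v \<in> F j then c j v else 0))" for x j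
  proof -
    have "A $ x $ j = (\<Sum>v\<in>F j. v $ x * c j v)"
      using arg_cong[OF Fc(3), of "\<lambda>v. v $ x" j] by (simp add: column_def right_scale_def)
    also have "\<dots> = (\<Sum>v\<in>G. v $ x * (if v \<in> F j then c j v else 0))"
      by (rule sum.mono_neutral_cong_left) (use G(1) in \<open>auto simp: G_def\<close>)
    finally show ?thesis .
  qed
  have P: "?P $ x $ y = (\<Sum>v\<in>G. v $ x * d v y)" for x y
    unfolding matrix_matrix_mult_def vec_lambda_beta A d_def sum_distrib_left sum_distrib_right
    by (subst sum.swap) (simp add: mult.assoc)
  have expand: "(\<Sum>v\<in>G. right_scale v (\<Sum>y\<in>UNIV. d v y * w $ y)) = w" if "w \<in> B" for w
  proof -
    have "(?P *v w) $ x = (\<Sum>v\<in>G. right_scale v (\<Sum>y\<in>UNIV. d v y * w $ y)) $ x" for x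
      unfolding matrix_vector_mult_def vec_lambda_beta P right_scale_def sum_component sum_distrib_left sum_distrib_right
      by (subst sum.swap) (simp add: mult.assoc)
    then have "?P *v w = (\<Sum>v\<in>G. right_scale v (\<Sum>y\<in>UNIV. d v y * w $ y))"
      by (intro vec_eq_iff[THEN iffD2] allI)
    then show ?thesis by (simp only: fix_B[OF that])
  qed
  have coeff: "w \<in> G \<and> (\<Sum>y\<in>UNIV. d w y * w $ y) = 1" if w: "w \<in> B" for w
  proof -
    \<comment> \<open>The coordinates of \<open>w\<close> through \<open>d\<close> minus the trivial
      ones. Independence gives \<open>e w = 0\<close>, which also forces \<open>w \<in> G\<close>,
      as otherwise \<open>e w = - 1\<close>.\<close>
    define e where "e v = (if v \<in> G then \<Sum>y\<in>UNIV. d v y * w $ y else 0) - (if v = w then 1 else 0)" for v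
    have "(\<Sum>v\<in>insert w G. right_scale v (e v)) =
      (\<Sum>v\<in>insert w G. right_scale v (if v \<in> G then \<Sum>y\<in>UNIV. d v y * w $ y else 0)) -
      (\<Sum>v\<in>insert w G. right_scale v (if v = w then 1 else 0))"
      unfolding sum_subtractf[symmetric] e_def by (simp add: right_scale_def vec_eq_iff right_diff_distrib)
    also have "(\<Sum>v\<in>insert w G. right_scale v (if v \<in> G then \<Sum>y\<in>UNIV. d v y * w $ y else 0)) =
      (\<Sum>v\<in>G. right_scale v (\<Sum>y\<in>UNIV. d v y * w $ y))"
      by (rule sum.mono_neutral_cong_right) (use G(1) in \<open>auto simp: right_scale_simps\<close>)
    also have "(\<Sum>v\<in>insert w G. right_scale v (if v = w then 1 else 0)) = (\<Sum>v\<in>{w}. right_scale v 1)"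
      by (rule sum.mono_neutral_cong_right) (use G(1) in \<open>auto simp: right_scale_simps\<close>)
    finally have "(\<Sum>v\<in>insert w G. right_scale v (e v)) = 0"
      by (simp add: expand[OF w] right_scale_simps)
    then have "e w = 0"
      using indep G w unfolding right_independent_def by (meson finite_insert insertI1 insert_subset)
    then show ?thesis by (auto simp: e_def split: if_splits)
  qed
  have "G = B" using G coeff by auto
  have "rtr ?P = (\<Sum>v\<in>G. \<Sum>x\<in>UNIV. qre (v $ x * d v x))"
    unfolding rtr_def P qre_sum by (rule sum.swap)
  also have "\<dots> = (\<Sum>v\<in>G. qre (\<Sum>x\<in>UNIV. d v x * v $ x))"
    by (simp only: qre_sum qre_mult_commute[of "_ $ _"])
  also have "\<dots> = (\<Sum>v\<in>G. 1)"
    by (rule sum.cong) (use coeff G(2) in auto)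
  finally show ?thesis using \<open>G = B\<close> by simp
qed

text \<open>The basis chosen in \<open>right_dim\<close> is arbitrary, but every basis has this many
  elements. Any inner inverse \<open>Y\<close> may be used, so statements on ranks reduce to
  traces.\<close>

lemma qrank_eq_rtr:
  fixes A :: "quat^'n^'m"
  assumes "A ** Y ** A = A"
  shows "real (qrank A) = rtr (A ** Y)"
proof -
  let ?basis = "\<lambda>B. right_independent B \<and> right_span B = right_span (columns A)"
  have "?basis (Eps ?basis)"
    by (rule someI_ex) (rule right_basis_exists[OF finite_columns])
  then have "real (card (Eps ?basis)) = rtr (A ** Y)"
    by (intro card_basis_eq_rtr[OF assms]) simp_all
  then show ?thesis by (simp only: qrank_def right_dim_def)
qed

section \<open>Rank and the Moore--Penrose inverse\<close>

lemma coadj_eq: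
  fixes H :: "'n::{finite,linorder} qmat"
  assumes "qhermitian H"
  shows "coadj (Suc m) H = minor_sum m H *\<^sub>R mat 1 - coadj m H ** H"
  using coadj_Suc[OF assms, of m] by (simp add: algebra_simps)

text \<open>By the recursion \<open>coadj m H\<close> is a polynomial in \<open>H\<close> with real
  coefficients; this is also why it is self-adjoint.\<close>

lemma coadj_commute:
  fixes H :: "'n::{finite,linorder} qmat"
  assumes "qhermitian H"
  shows "H ** coadj m H = coadj m H ** H"
proof (induction m)
  case (Suc m)
  then have "H ** (coadj m H ** H) = coadj m H ** H ** H" by (simp add: matrix_mul_assoc)
  then show ?case
    by (simp add: coadj_eq[OF assms] matrix_diff_ldistrib matrix_diff_rdistrib matrix_scaleR_right matrix_scaleR_left)
qed simp

lemma qadj_coadj: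
  fixes H :: "'n::{finite,linorder} qmat"
  assumes "qhermitian H"
  shows "qadj (coadj m H) = coadj m H"
proof (induction m)
  case (Suc m)
  then show ?case
    using assms by (simp add: coadj_eq[OF assms] qadj_mult coadj_commute[OF assms] qhermitian_def)
qed simp

text \<open>Each label set of size \<open>m\<close> is counted once for each of its \<open>m\<close>
  labels.\<close>

lemma rtr_coadj_mult:
  fixes H :: "'n::{finite,linorder} qmat"
  assumes "qhermitian H"
  shows "rtr (coadj m H ** H) = m * minor_sum m H"
proof -
  have "rtr (coadj m H ** H) = (\<Sum>i\<in>UNIV. \<Sum>\<beta>\<in>ksets m. if i \<in> \<beta> then minor H \<beta> else 0)"
    unfolding rtr_def coadj_mult_diagonal[OF assms] qre_of_real
    by (intro sum.cong refl sum.mono_neutral_cong_left) (auto simp: ksets_def ksets_at_def)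
  also have "\<dots> = (\<Sum>\<beta>\<in>ksets m. \<Sum>i\<in>UNIV. if i \<in> \<beta> then minor H \<beta> else 0)"
    by (rule sum.swap)
  also have "\<dots> = (\<Sum>\<beta>\<in>ksets m. real m * minor H \<beta>)"
    by (rule sum.cong) (simp_all add: ksets_def sum.If_cases)
  finally show ?thesis by (simp add: minor_sum_def sum_distrib_left)
qed

text \<open>\<open>Y ** H ** H\<close> is a left factor of the product of \<open>Y ** H\<close> with
  its adjoint.\<close>

lemma hermitian_cancel:
  assumes "qadj H = H" and "Y ** H ** H = 0"
  shows "Y ** H = 0"
proof (rule mult_qadj_eq_0)
  have "Y ** H ** qadj (Y ** H) = Y ** H ** H ** qadj Y"
    by (simp add: qadj_mult assms(1) matrix_mul_assoc)
  then show "Y ** H ** qadj (Y ** H) = 0" by (simp add: assms(2))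
qed

text \<open>
  If \<open>r\<close> is the last index with \<open>minor_sum r H \<noteq> 0\<close>, then \<open>coadj r H ** H\<close> is a multiple of the
  orthogonal projection onto the column space of \<open>H\<close>, and its trace identifies \<open>r\<close> as the rank.
\<close>

lemma
  fixes H :: "'n::{finite,linorder} qmat"
  assumes H: "qhermitian H"
  shows minor_sum_qrank_nonzero: "minor_sum (qrank H) H \<noteq> 0"
    and coadj_qrank: "coadj (qrank H) H ** H ** H = minor_sum (qrank H) H *\<^sub>R H"
proof -
  let ?N = "CARD('n)"
  have adj: "qadj H = H" using H by (simp add: qhermitian_def)
  define r where "r = Max {m. m \<le> ?N \<and> minor_sum m H \<noteq> 0}"
  have fin: "finite {m. m \<le> ?N \<and> minor_sum m H \<noteq> 0}" by simp
  moreover have "0 \<in> {m. m \<le> ?N \<and> minor_sum m H \<noteq> 0}" by simp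
  ultimately have "r \<in> {m. m \<le> ?N \<and> minor_sum m H \<noteq> 0}"
    unfolding r_def by (intro Max_in) auto
  then have r: "r \<le> ?N" "minor_sum r H \<noteq> 0" by auto
  have above: "minor_sum m H = 0" if "r < m" "m \<le> ?N" for m
  proof (rule ccontr)
    assume "minor_sum m H \<noteq> 0"
    then have "m \<le> r" unfolding r_def using fin that by (intro Max_ge) auto
    then show False using that by simp
  qed
  \<comment> \<open>Above \<open>r\<close> the recursion reads
    \<open>coadj (Suc m) H = - (coadj m H ** H)\<close>. Descending from \<open>Suc m\<close> to
    \<open>m\<close> thus costs one surplus factor \<open>H\<close>, which
    \<open>hermitian_cancel\<close> removes.\<close>
  have vanish: "coadj m H ** H = 0" if "m \<le> Suc ?N" "r < m" for m
    using that
  proof (induction m rule: inc_induct)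
    case base then show ?case by simp
  next
    case (step m)
    have "coadj (Suc m) H = - (coadj m H ** H)"
      using step above[of m] by (simp add: coadj_eq[OF H])
    moreover have "coadj (Suc m) H ** H = 0" using step by simp
    ultimately have "(0 - coadj m H ** H) ** H = 0" by simp
    then have "coadj m H ** H ** H = 0" by (simp only: matrix_diff_rdistrib matrix_mul_zero) simp
    then show ?case by (rule hermitian_cancel[OF adj])
  qed
  have "coadj (Suc r) H ** H = 0" by (rule vanish) (use r in auto)
  then have r2: "coadj r H ** H ** H = minor_sum r H *\<^sub>R H"
    by (simp add: coadj_eq[OF H] matrix_diff_rdistrib matrix_scaleR_left)
  define Y where "Y = (1 / minor_sum r H) *\<^sub>R coadj r H"
  have "H ** Y ** H = H"
    using r r2 by (simp add: Y_def matrix_scaleR_right matrix_scaleR_left coadj_commute[OF H])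
  then have "real (qrank H) = rtr (H ** Y)" by (rule qrank_eq_rtr)
  also have "\<dots> = real r"
    using r by (simp add: Y_def matrix_scaleR_right coadj_commute[OF H] rtr_scaleR rtr_coadj_mult[OF H])
  finally have "qrank H = r" by simp
  with r r2 show "minor_sum (qrank H) H \<noteq> 0" "coadj (qrank H) H ** H ** H = minor_sum (qrank H) H *\<^sub>R H"
    by simp_all
qed

text \<open>The projections \<open>A ** X\<close> and \<open>A ** Y\<close> absorb each other, and
  adjoints exchange the order of their product, so they agree; likewise \<open>X ** A\<close> and
  \<open>Y ** A\<close>.\<close>

lemma penrose_unique:
  fixes A :: "quat^'n^'m"
  assumes "A ** X ** A = A" "X ** A ** X = X" "qadj (A ** X) = A ** X" "qadj (X ** A) = X ** A"
    and "A ** Y ** A = A" "Y ** A ** Y = Y" "qadj (A ** Y) = A ** Y" "qadj (Y ** A) = Y ** A"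
  shows "X = Y"
proof -
  have "A ** X = (A ** Y) ** (A ** X)" using assms(5) by (simp add: matrix_mul_assoc)
  also have "\<dots> = qadj ((A ** X) ** (A ** Y))" by (simp add: qadj_mult[of "A ** X"] assms)
  also have "(A ** X) ** (A ** Y) = A ** Y" using assms(1) by (simp add: matrix_mul_assoc)
  finally have AX: "A ** X = A ** Y" by (simp add: assms)
  have "X ** A = (X ** A) ** (Y ** A)"
    using assms(5) by (metis matrix_mul_assoc)
  also have "\<dots> = qadj ((Y ** A) ** (X ** A))" by (simp add: qadj_mult[of "Y ** A"] assms)
  also have "(Y ** A) ** (X ** A) = Y ** A" using assms(1) by (metis matrix_mul_assoc)
  finally have XA: "X ** A = Y ** A" by (simp add: assms)
  have "X = X ** (A ** X)" using assms(2) by (simp add: matrix_mul_assoc)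
  also have "\<dots> = Y ** A ** Y" by (simp add: AX matrix_mul_assoc XA)
  finally show ?thesis using assms(6) by simp
qed

lemma qhermitian_gram: "qhermitian (qadj A ** A)"
  by (simp add: qhermitian_def qadj_mult)

lemma gram_cancel:
  assumes "qadj A ** A ** Z = 0"
  shows "A ** Z = 0"
proof -
  have "qadj (A ** Z) ** qadj (qadj (A ** Z)) = qadj Z ** (qadj A ** A ** Z)"
    by (simp add: qadj_mult matrix_mul_assoc)
  then have "qadj (A ** Z) ** qadj (qadj (A ** Z)) = 0" by (simp only: assms matrix_mul_zero)
  then have "qadj (A ** Z) = 0" by (rule mult_qadj_eq_0)
  then have "qadj (qadj (A ** Z)) = 0" by simp
  then show ?thesis by (simp only: qadj_simps)
qed

text \<open>The construction starts with the rank of \<open>qadj A ** A\<close>. It equals that of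
  \<open>A\<close> because the idempotents \<open>A ** G\<close> and \<open>G ** A = H ** Y\<close>
  have the same real trace.\<close>

lemma
  fixes A :: "'n::{finite,linorder} qmat"
  shows gram_minor_sum_nonzero: "minor_sum (qrank A) (qadj A ** A) \<noteq> 0"
    and mp_inverse_coadj:
      "mp_inverse A = (1 / minor_sum (qrank A) (qadj A ** A)) *\<^sub>R (coadj (qrank A) (qadj A ** A) ** qadj A)"
    and mp_inverse_1: "A ** mp_inverse A ** A = A"
    and mp_inverse_3: "qadj (A ** mp_inverse A) = A ** mp_inverse A"
proof -
  define H where "H = qadj A ** A"
  have H: "qhermitian H" unfolding H_def by (rule qhermitian_gram)
  have adj: "qadj H = H" using H by (simp add: qhermitian_def)
  define r where "r = qrank H"
  define Y where "Y = (1 / minor_sum r H) *\<^sub>R coadj r H"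
  define G where "G = Y ** qadj A"
  have d: "minor_sum r H \<noteq> 0" unfolding r_def by (rule minor_sum_qrank_nonzero[OF H])
  have YH: "H ** Y = Y ** H" by (simp add: Y_def matrix_scaleR_right matrix_scaleR_left coadj_commute[OF H])
  have Yadj: "qadj Y = Y" by (simp add: Y_def qadj_coadj[OF H])
  have YHH: "Y ** H ** H = H"
    using d coadj_qrank[OF H, folded r_def] by (simp add: Y_def matrix_scaleR_left)
  \<comment> \<open>\<open>H ** (Y ** H) = H\<close>; cancelling \<open>qadj A\<close> on the left
    carries this identity over from \<open>H\<close> to \<open>A\<close>.\<close>
  have "qadj A ** A ** (Y ** H - mat 1) = 0"
    unfolding H_def[symmetric] by (simp add: matrix_diff_ldistrib matrix_mul_assoc YH YHH)
  then have "A ** (Y ** H - mat 1) = 0" by (rule gram_cancel)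
  then have AYH: "A ** Y ** H = A" by (simp add: matrix_diff_ldistrib matrix_mul_assoc)
  have "H ** Y ** qadj A = qadj (A ** Y ** H)" by (simp add: qadj_mult adj Yadj matrix_mul_assoc)
  then have HYA: "H ** Y ** qadj A = qadj A" by (simp add: AYH)
  have 1: "A ** G ** A = A" using AYH by (simp add: G_def H_def matrix_mul_assoc)
  have GA: "G ** A = Y ** H" by (simp add: G_def H_def matrix_mul_assoc)
  have "G ** A ** G = Y ** (H ** Y ** qadj A)" unfolding GA by (simp add: G_def matrix_mul_assoc)
  then have 2: "G ** A ** G = G" by (simp add: HYA G_def)
  have 3: "qadj (A ** G) = A ** G" by (simp add: G_def qadj_mult Yadj matrix_mul_assoc)
  have 4: "qadj (G ** A) = G ** A" unfolding GA by (simp add: qadj_mult adj Yadj YH)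
  have mp: "mp_inverse A = G"
    unfolding mp_inverse_def
    by (rule the_equality) (use 1 2 3 4 penrose_unique in \<open>blast+\<close>)
  have "real (qrank A) = rtr (A ** G)" by (rule qrank_eq_rtr[OF 1])
  also have "\<dots> = rtr (G ** A)" by (rule rtr_mult_commute)
  also have "\<dots> = rtr (H ** Y)" by (simp add: GA YH)
  also have "\<dots> = real (qrank H)"
    by (rule qrank_eq_rtr[symmetric]) (simp add: YH YHH)
  finally have qr: "qrank A = r" by (simp add: r_def)
  show "minor_sum (qrank A) (qadj A ** A) \<noteq> 0" using d by (simp add: qr H_def)
  show "mp_inverse A = (1 / minor_sum (qrank A) (qadj A ** A)) *\<^sub>R (coadj (qrank A) (qadj A ** A) ** qadj A)"
    unfolding mp qr by (simp add: G_def Y_def H_def matrix_scaleR_left)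
  show "A ** mp_inverse A ** A = A" "qadj (A ** mp_inverse A) = A ** mp_inverse A"
    unfolding mp using 1 3 by simp_all
qed

text \<open>\<open>qadj (mp_inverse A)\<close> is an inner inverse of \<open>qadj A\<close>, and the
  real trace ignores adjoints and the order of two factors.\<close>

lemma qrank_qadj:
  fixes A :: "'n::{finite,linorder} qmat"
  shows "qrank (qadj A) = qrank A"
proof -
  have "qadj A ** qadj (mp_inverse A) ** qadj A = qadj (A ** mp_inverse A ** A)"
    by (simp add: qadj_mult matrix_mul_assoc)
  then have "real (qrank (qadj A)) = rtr (qadj A ** qadj (mp_inverse A))"
    by (intro qrank_eq_rtr) (simp add: mp_inverse_1)
  also have "\<dots> = rtr (mp_inverse A ** A)"
    by (simp add: qadj_mult[symmetric] rtr_qadj)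
  also have "\<dots> = rtr (A ** mp_inverse A)" by (rule rtr_mult_commute)
  also have "\<dots> = real (qrank A)" by (rule qrank_eq_rtr[OF mp_inverse_1, symmetric])
  finally show ?thesis by simp
qed

text \<open>
  Here \<open>P\<close> is the difference of the orthogonal projections onto the column spaces of \<open>B\<close> and of
  \<open>B ** Y\<close>; it is itself an orthogonal projection, whose trace is the difference of the ranks.
\<close>

lemma
  fixes B Y :: "'n::{finite,linorder} qmat"
  shows qrank_mult_le: "qrank (B ** Y) \<le> qrank B"
    and qrank_mult_eq: "qrank (B ** Y) = qrank B \<Longrightarrow> \<exists>Z. B = B ** Y ** Z"
proof -
  define A where "A = B ** Y"
  define PA where "PA = A ** mp_inverse A"
  define PB where "PB = B ** mp_inverse B"
  define P where "P = PB - PA"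
  have adj: "qadj PA = PA" "qadj PB = PB" by (simp_all add: PA_def PB_def mp_inverse_3)
  have idem: "PA ** PA = PA" "PB ** PB = PB"
    by (simp_all add: PA_def PB_def matrix_mul_assoc mp_inverse_1)
  have "PB ** A = A" by (simp add: PB_def A_def matrix_mul_assoc mp_inverse_1)
  then have BA: "PB ** PA = PA" by (simp add: PA_def matrix_mul_assoc)
  have AB: "PA ** PB = PA" using arg_cong[OF BA, of qadj] by (simp add: qadj_mult adj)
  have PP: "P ** qadj P = P"
    by (simp add: P_def adj matrix_diff_ldistrib matrix_diff_rdistrib idem AB BA)
  have rP: "rtr P = real (qrank B) - real (qrank A)"
    using qrank_eq_rtr[OF mp_inverse_1[of A]] qrank_eq_rtr[OF mp_inverse_1[of B]]
    by (simp add: P_def rtr_diff PA_def PB_def)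
  have "rtr P \<ge> 0" using rtr_mult_qadj_nonneg[of P] by (simp add: PP)
  then show "qrank (B ** Y) \<le> qrank B" by (simp add: rP A_def)
  assume "qrank (B ** Y) = qrank B"
  then have "rtr (P ** qadj P) = 0" by (simp add: PP rP A_def)
  then have "P = 0" by (rule rtr_mult_qadj_eq_0)
  then have "PA = PB" by (simp add: P_def)
  then have "PA ** B = B" by (simp add: PB_def mp_inverse_1)
  then have "B = B ** Y ** (mp_inverse A ** B)" by (simp add: PA_def A_def matrix_mul_assoc)
  then show "\<exists>Z. B = B ** Y ** Z" by blast
qed

section \<open>Powers and the index\<close>

lemma mpow_commute: "A ** mpow A m = mpow A m ** A"
proof (induction m)
  case (Suc m)
  have "A ** mpow A (Suc m) = A ** (mpow A m ** A)" using Suc by simp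
  then show ?case by (simp add: matrix_mul_assoc)
qed simp

lemma mpow_add: "mpow A (m + l) = mpow A m ** mpow A l"
  by (induction m) (simp_all add: matrix_mul_assoc)

lemma qadj_mpow: "qadj (mpow A m) = mpow (qadj A) m"
  by (induction m) (simp_all add: qadj_mult mpow_commute)

text \<open>The \<open>LEAST\<close> in \<open>qindex\<close> is attained, since the ranks of
  successive powers weakly decrease and cannot drop forever.\<close>

lemma qrank_qindex:
  fixes A :: "'n::{finite,linorder} qmat"
  shows "qrank (mpow A (qindex A + 1)) = qrank (mpow A (qindex A))"
proof -
  have dec: "qrank (mpow A (m + 1)) \<le> qrank (mpow A m)" for m
    using qrank_mult_le[of "mpow A m" A] by (simp add: mpow_commute)
  define f where "f m = qrank (mpow A m)" for m
  have "\<exists>m. f (m + 1) = f m"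
  proof (rule ccontr)
    assume "\<nexists>m. f (m + 1) = f m"
    then have lt: "f (m + 1) < f m" for m using dec[of m] by (simp add: f_def le_neq_implies_less)
    have "f m + m \<le> f 0" for m
    proof (induction m)
      case (Suc m)
      then show ?case using lt[of m] by simp
    qed simp
    from this[of "Suc (f 0)"] show False by simp
  qed
  then show ?thesis unfolding qindex_def f_def by (rule LeastI_ex)
qed

text \<open>For \<open>k = qindex A\<close> equal ranks give
  \<open>mpow A k = mpow A k ** A ** Z\<close>; applying this repeatedly raises the
  exponent.\<close>

lemma mpow_qindex_right:
  fixes A :: "'n::{finite,linorder} qmat"
  shows "\<exists>Y. mpow A (qindex A) = mpow A (qindex A + m) ** Y"
proof (induction m)
  case 0 show ?case by (auto intro: exI[of _ "mat 1"])
next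
  case (Suc m)
  then obtain Y where Y: "mpow A (qindex A) = mpow A (qindex A + m) ** Y" by blast
  have "qrank (mpow A (qindex A) ** A) = qrank (mpow A (qindex A))"
    using qrank_qindex[of A] by (simp add: mpow_commute)
  then obtain Z where Z: "mpow A (qindex A) = mpow A (qindex A) ** A ** Z"
    using qrank_mult_eq by blast
  have "mpow A (qindex A + m) = mpow A m ** mpow A (qindex A)"
    by (simp add: mpow_add[symmetric] add.commute)
  also have "\<dots> = mpow A m ** (mpow A (qindex A) ** A ** Z)" using Z by simp
  also have "\<dots> = mpow A (qindex A + Suc m) ** Z"
    by (simp add: matrix_mul_assoc mpow_add[symmetric] mpow_commute add.commute)
  finally show ?case using Y by (metis matrix_mul_assoc)
qed

text \<open>The factorization on the other side, taken from the adjoint: its powers have the same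
  ranks, hence it has the same index.\<close>

lemma mpow_qindex_left:
  fixes A :: "'n::{finite,linorder} qmat"
  shows "\<exists>Y. mpow A (qindex A) = Y ** mpow A (qindex A + m)"
proof -
  have eq: "qrank (mpow (qadj A) m) = qrank (mpow A m)" for m
    by (simp add: qadj_mpow[symmetric] qrank_qadj)
  have "qindex (qadj A) = qindex A" by (simp add: qindex_def eq del: mpow.simps)
  then obtain Y where "mpow (qadj A) (qindex A) = mpow (qadj A) (qindex A + m) ** Y"
    using mpow_qindex_right[of "qadj A" m] by auto
  then have "qadj (mpow (qadj A) (qindex A)) = qadj Y ** qadj (mpow (qadj A) (qindex A + m))"
    by (simp add: qadj_mult)
  then show ?thesis by (auto simp: qadj_mpow)
qed

section \<open>Drazin and MPD inverses\<close>

text \<open>Here \<open>T = B ** A ** B\<close>, and the choice of the index gives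
  \<open>B = T ** Y = Z ** T\<close>. With \<open>T ** M ** T = T\<close> these factorizations yield
  \<open>D ** A ** B = B\<close> and \<open>B ** A ** D = B\<close>.\<close>

lemma
  fixes A :: "'n::{finite,linorder} qmat"
  defines "B \<equiv> mpow A (qindex A)" and "T \<equiv> mpow A (2 * qindex A + 1)"
  shows drazin_inverse_eq: "drazin_inverse A = B ** mp_inverse T ** B"
    and drazin_inverse_mpow: "drazin_inverse A ** A ** B = B"
    and mpow_drazin_inverse: "B ** A ** drazin_inverse A = B"
    and drazin_inverse_outer: "drazin_inverse A ** A ** drazin_inverse A = drazin_inverse A"
    and drazin_inverse_commute: "A ** drazin_inverse A = drazin_inverse A ** A"
    and qrank_mpow_qindex: "qrank T = qrank B"
proof -
  define k where "k = qindex A"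
  define M where "M = mp_inverse T"
  define D where "D = B ** M ** B"
  have comm: "A ** B = B ** A" unfolding B_def by (rule mpow_commute)
  have Suc: "mpow A (k + 1) = A ** B" by (simp add: B_def k_def)
  have ind: "k + (k + 1) = 2 * k + 1" by simp
  have "T = mpow A (k + (k + 1))" unfolding T_def k_def[symmetric] ind ..
  also have "\<dots> = B ** (A ** B)" unfolding mpow_add[of A k "k + 1"] Suc by (simp only: B_def k_def)
  finally have T: "T = B ** A ** B" by (simp add: matrix_mul_assoc)
  obtain Y where Y: "B = T ** Y"
    using mpow_qindex_right[of A "k + 1"] unfolding k_def[symmetric] ind unfolding B_def T_def k_def by blast
  obtain Z where Z: "B = Z ** T"
    using mpow_qindex_left[of A "k + 1"] unfolding k_def[symmetric] ind unfolding B_def T_def k_def by blast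
  have TMT: "T ** M ** T = T" unfolding M_def by (rule mp_inverse_1)
  have "qrank T \<le> qrank B" unfolding T using qrank_mult_le[of B "A ** B"] by (simp add: matrix_mul_assoc)
  moreover have "qrank B \<le> qrank T" using qrank_mult_le[of T Y] Y by simp
  ultimately show "qrank T = qrank B" by simp
  have "D ** A ** B = B ** M ** T" by (simp add: D_def T matrix_mul_assoc)
  also have "\<dots> = Z ** (T ** M ** T)" by (subst Z) (simp add: matrix_mul_assoc)
  finally have DAB: "D ** A ** B = B" by (simp add: TMT Z[symmetric])
  have "B ** A ** D = T ** M ** B" by (simp add: D_def T matrix_mul_assoc)
  also have "\<dots> = T ** M ** T ** Y" by (subst Y) (simp add: matrix_mul_assoc)
  finally have BAD: "B ** A ** D = B" by (simp add: TMT Y[symmetric])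
  have "D ** A ** D = (D ** A ** B) ** M ** B" by (simp add: D_def matrix_mul_assoc)
  then have DAD: "D ** A ** D = D" by (simp only: DAB D_def[symmetric])
  \<comment> \<open>This product is evaluated twice, by absorbing \<open>D\<close> from the left and
    from the right; comparing the results gives commutation.\<close>
  have "(D ** A) ** (A ** D) = D ** A ** (A ** B) ** (M ** B)" by (simp add: D_def matrix_mul_assoc)
  also have "\<dots> = (D ** A ** B) ** A ** (M ** B)" by (simp add: comm matrix_mul_assoc)
  also have "\<dots> = (A ** B) ** (M ** B)" by (simp add: DAB comm)
  finally have 1: "(D ** A) ** (A ** D) = A ** D" by (simp add: D_def matrix_mul_assoc)
  have "(D ** A) ** (A ** D) = B ** M ** (B ** A) ** A ** D" by (simp add: D_def matrix_mul_assoc)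
  also have "\<dots> = B ** M ** (A ** B) ** A ** D" by (simp only: comm)
  also have "\<dots> = B ** M ** A ** (B ** A ** D)" by (simp only: matrix_mul_assoc)
  also have "\<dots> = B ** M ** (A ** B)" by (simp add: BAD matrix_mul_assoc)
  finally have 2: "(D ** A) ** (A ** D) = D ** A" by (simp add: D_def comm matrix_mul_assoc)
  have AD: "A ** D = D ** A" using 1 2 by simp
  have D3: "D ** mpow A (k + 1) = B" using DAB by (simp only: Suc matrix_mul_assoc)
  have "drazin_inverse A = D"
    unfolding drazin_inverse_def k_def[symmetric]
  proof (rule the_equality)
    show "D ** A ** D = D \<and> A ** D = D ** A \<and> D ** mpow A (k + 1) = mpow A k"
      using DAD AD D3 by (simp add: B_def k_def)
    fix X assume "X ** A ** X = X \<and> A ** X = X ** A \<and> X ** mpow A (k + 1) = mpow A k"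
    then have XAX: "X ** A ** X = X" and AX: "A ** X = X ** A" and "X ** mpow A (k + 1) = mpow A k"
      by blast+
    then have XAB: "X ** A ** B = B" by (simp only: Suc matrix_mul_assoc) (simp add: B_def k_def)
    \<comment> \<open>\<open>X = X ** (A ** X) = X ** X ** A\<close>, so powers of \<open>A\<close>
      can be split off on the right as often as wanted.\<close>
    have "\<exists>V. X = V ** mpow A m" for m
    proof (induction m)
      case 0 show ?case by (auto intro: exI[of _ X])
    next
      case (Suc m)
      then obtain V where V: "X = V ** mpow A m" by blast
      have "X = X ** (A ** X)" using XAX by (simp add: matrix_mul_assoc)
      also have "\<dots> = X ** (V ** mpow A m ** A)" by (subst AX) (simp only: V[symmetric])
      also have "\<dots> = (X ** V) ** mpow A (Suc m)" by (simp add: mpow_commute matrix_mul_assoc)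
      finally show ?case by blast
    qed
    then obtain V where V: "X = V ** B" unfolding B_def by blast
    have "X ** A ** D = V ** (B ** A ** D)" by (simp add: V matrix_mul_assoc)
    then have "X ** A ** D = X" by (simp add: BAD V)
    moreover have "X ** A ** D = (X ** A ** B) ** M ** B" by (simp add: D_def matrix_mul_assoc)
    ultimately show "X = D" by (simp add: XAB D_def)
  qed
  then show "drazin_inverse A = B ** mp_inverse T ** B" "drazin_inverse A ** A ** B = B"
    "B ** A ** drazin_inverse A = B" "drazin_inverse A ** A ** drazin_inverse A = drazin_inverse A"
    "A ** drazin_inverse A = drazin_inverse A ** A"
    using DAB BAD DAD AD by (simp_all add: D_def M_def)
qed

lemma mpd_inverse_eq:
  fixes A :: "'n::{finite,linorder} qmat"
  shows "mpd_inverse A = mp_inverse A ** A ** drazin_inverse A"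
proof -
  let ?P = "mp_inverse A" and ?D = "drazin_inverse A" and ?B = "mpow A (qindex A)"
  \<comment> \<open>The Drazin inverse starts with \<open>?B\<close>. Hence
    \<open>X ** (A ** ?D)\<close> involves \<open>X\<close> only through \<open>X ** ?B\<close>,
    which the third condition prescribes.\<close>
  define W where "W = mp_inverse (mpow A (2 * qindex A + 1)) ** ?B"
  have D: "?D = ?B ** W" unfolding drazin_inverse_eq[of A] W_def by (simp only: matrix_mul_assoc)
  have 1: "A ** (?P ** A ** ?D) = A ** ?D"
    using mp_inverse_1[of A] by (simp add: matrix_mul_assoc)
  show ?thesis
    unfolding mpd_inverse_def
  proof (rule the_equality)
    have "?P ** A ** ?D ** A ** (?P ** A ** ?D) = ?P ** A ** ?D ** (A ** (?P ** A ** ?D))"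
      by (simp only: matrix_mul_assoc)
    also have "\<dots> = ?P ** A ** (?D ** A ** ?D)" unfolding 1 by (simp only: matrix_mul_assoc)
    finally have "?P ** A ** ?D ** A ** (?P ** A ** ?D) = ?P ** A ** ?D"
      by (simp only: drazin_inverse_outer)
    moreover have "?P ** A ** ?D ** ?B = ?P ** ?B"
    proof -
      have "?P ** A ** ?D ** ?B = ?P ** (A ** ?D ** ?B)" by (simp only: matrix_mul_assoc)
      then show ?thesis by (simp only: drazin_inverse_commute drazin_inverse_mpow)
    qed
    ultimately show "?P ** A ** ?D ** A ** (?P ** A ** ?D) = ?P ** A ** ?D \<and>
      A ** (?P ** A ** ?D) = A ** ?D \<and> ?P ** A ** ?D ** ?B = ?P ** ?B"
      using 1 by simp
    fix X assume X: "X ** A ** X = X \<and> A ** X = A ** ?D \<and> X ** ?B = ?P ** ?B"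
    have "X = X ** (A ** X)" using X by (metis matrix_mul_assoc)
    also have "A ** X = A ** ?D" using X by blast
    also have "X ** (A ** ?D) = X ** (A ** ?B) ** W" by (simp only: D matrix_mul_assoc)
    also have "\<dots> = (X ** ?B) ** A ** W" by (simp only: mpow_commute matrix_mul_assoc)
    also have "\<dots> = ?P ** (?B ** A) ** W" using X by (simp add: matrix_mul_assoc)
    also have "\<dots> = ?P ** A ** ?D" by (simp only: mpow_commute[symmetric] D matrix_mul_assoc)
    finally show "X = ?P ** A ** ?D" .
  qed
qed

section \<open>Determinantal representations\<close>

lemma coadj_gram:
  fixes A :: "'n::{finite,linorder} qmat"
  shows "coadj (qrank A) (qadj A ** A) ** qadj A = minor_sum (qrank A) (qadj A ** A) *\<^sub>R mp_inverse A"
  using gram_minor_sum_nonzero[of A] by (subst mp_inverse_coadj) simp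

lemma column_coadj:
  fixes H :: "'n::{finite,linorder} qmat"
  assumes "qhermitian H"
  shows "(\<chi> f j. \<Sum>\<beta>\<in>ksets_at m f. cdet \<beta> f (repl_col H f (column j B))) = coadj m H ** B"
  by (simp add: vec_eq_iff coadj_mult_column[OF assms])

text \<open>The inner sums make \<open>V_mat A\<close> a real multiple of
  \<open>mp_inverse T ** mpow A (qindex A)\<close>, and the outer ones turn \<open>qadj A\<close>
  into a multiple of \<open>mp_inverse A\<close>; what remains is
  \<open>mp_inverse A ** A ** drazin_inverse A\<close>.\<close>

lemma cdet_representation:
  fixes A :: "'n::{finite,linorder} qmat"
  defines "s \<equiv> qrank A" and "s1 \<equiv> qrank (mpow A (qindex A))" and "T \<equiv> mpow A (2 * qindex A + 1)"
  shows "(\<Sum>\<beta>\<in>ksets_at s i. cdet \<beta> i (repl_col (qadj A ** A) i (column j (V_tilde A)))) =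
    (minor_sum s (qadj A ** A) * minor_sum s1 (qadj T ** T)) *\<^sub>R mpd_inverse A $ i $ j"
proof -
  let ?B = "mpow A (qindex A)"
  have s1: "qrank T = s1" unfolding s1_def T_def by (rule qrank_mpow_qindex)
  have "V_mat A = coadj s1 (qadj T ** T) ** (qadj T ** ?B)"
    unfolding V_mat_def Let_def A_hat_def T_def[symmetric] s1_def[symmetric]
    by (rule column_coadj[OF qhermitian_gram])
  also have "\<dots> = minor_sum s1 (qadj T ** T) *\<^sub>R (mp_inverse T ** ?B)"
    using coadj_gram[of T] unfolding s1 by (simp add: matrix_mul_assoc matrix_scaleR_left)
  finally have V: "V_mat A = minor_sum s1 (qadj T ** T) *\<^sub>R (mp_inverse T ** ?B)" .
  have "coadj s (qadj A ** A) ** V_tilde A =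
    coadj s (qadj A ** A) ** qadj A ** (A ** ?B) ** V_mat A"
    by (simp add: V_tilde_def matrix_mul_assoc)
  also have "\<dots> = (minor_sum s (qadj A ** A) * minor_sum s1 (qadj T ** T)) *\<^sub>R
    (mp_inverse A ** A ** (?B ** mp_inverse T ** ?B))"
    unfolding s_def coadj_gram V by (simp add: matrix_scaleR_left matrix_scaleR_right matrix_mul_assoc)
  also have "?B ** mp_inverse T ** ?B = drazin_inverse A"
    unfolding T_def by (rule drazin_inverse_eq[symmetric])
  finally show ?thesis
    unfolding coadj_mult_column[OF qhermitian_gram] mpd_inverse_eq by simp
qed

text \<open>
  For Hermitian \<open>A\<close> both \<open>A ** drazin_inverse A\<close> and the normalized \<open>coadj ** A\<^sup>k\<^sup>+\<^sup>1\<close> are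
  the orthogonal projection onto the column space of \<open>A\<^sup>k\<close>.
\<close>

lemma hermitian_representation:
  fixes A :: "'n::{finite,linorder} qmat"
  assumes H: "qhermitian A"
  defines "s \<equiv> qrank A" and "s1 \<equiv> qrank (mpow A (qindex A))" and "G \<equiv> mpow A (qindex A + 1)"
  shows "coadj s (mpow A 2) ** mpow A (qindex A + 2) ** coadj s1 G =
    (minor_sum s (mpow A 2) * minor_sum s1 G) *\<^sub>R mpd_inverse A"
proof -
  let ?D = "drazin_inverse A" and ?B = "mpow A (qindex A)"
  have adj: "qadj A = A" using H by (simp add: qhermitian_def)
  have A2: "mpow A 2 = qadj A ** A" by (simp add: adj numeral_2_eq_2)
  have G: "qhermitian G" by (simp only: qhermitian_def G_def qadj_mpow adj)
  have rG: "qrank G = s1" unfolding G_def s1_def by (rule qrank_qindex)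
  let ?d = "minor_sum s1 G" and ?L = "coadj s1 G"
  have d: "?d \<noteq> 0" using minor_sum_qrank_nonzero[OF G] by (simp only: rG) simp
  have LGG: "?L ** G ** G = ?d *\<^sub>R G" using coadj_qrank[OF G] by (simp only: rG)
  have GB: "G = A ** ?B" by (simp add: G_def)
  define W where "W = mp_inverse (mpow A (2 * qindex A + 1)) ** ?B"
  have D: "?D = ?B ** W" unfolding drazin_inverse_eq[of A] W_def by (simp only: matrix_mul_assoc)
  \<comment> \<open>One product, two evaluations: \<open>?L ** G\<close> scales
    \<open>A ** ?D = G ** W\<close> by \<open>?d\<close>, while \<open>G\<close> absorbs
    \<open>A ** ?D\<close>.\<close>
  have "?L ** G ** (A ** ?D) = ?L ** G ** G ** W" by (simp only: GB D matrix_mul_assoc)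
  also have "\<dots> = ?d *\<^sub>R (A ** ?D)" unfolding LGG by (simp add: GB D matrix_mul_assoc matrix_scaleR_left)
  finally have 1: "?L ** G ** (A ** ?D) = ?d *\<^sub>R (A ** ?D)" .
  have "G ** (A ** ?D) = A ** (?B ** A ** ?D)" by (simp only: GB matrix_mul_assoc)
  then have "G ** (A ** ?D) = G" by (simp only: mpow_drazin_inverse GB)
  then have 2: "?L ** G ** (A ** ?D) = ?L ** G" by (simp only: matrix_mul_assoc[symmetric])
  have GL: "G ** ?L = ?d *\<^sub>R (A ** ?D)" using 1 2 coadj_commute[OF G] by simp
  have "mpow A (qindex A + 2) = A ** G" by (simp add: G_def numeral_2_eq_2)
  then have "coadj s (mpow A 2) ** mpow A (qindex A + 2) ** ?L = coadj s (mpow A 2) ** A ** (G ** ?L)"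
    by (simp add: matrix_mul_assoc)
  also have "coadj s (mpow A 2) ** A = minor_sum s (mpow A 2) *\<^sub>R mp_inverse A"
    using coadj_gram[of A] by (simp only: A2 adj s_def)
  finally show ?thesis
    unfolding GL mpd_inverse_eq by (simp add: matrix_scaleR_left matrix_scaleR_right matrix_mul_assoc)
qed

text \<open>Provides \<open>s > 0\<close> in the theorem. Splitting \<open>A\<close> off the power
  fails for index 0; the Drazin inverse supplies the factorization in all cases.\<close>

lemma qrank_mpow_qindex_le:
  fixes A :: "'n::{finite,linorder} qmat"
  shows "qrank (mpow A (qindex A)) \<le> qrank A"
proof -
  have "mpow A (qindex A) = A ** (drazin_inverse A ** mpow A (qindex A))"
    using drazin_inverse_mpow[of A] by (simp only: matrix_mul_assoc drazin_inverse_commute)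
  then show ?thesis using qrank_mult_le by metis
qed

theorem theorem3p14:
  fixes A X :: "'n::{finite,linorder} qmat" and s k s1 :: nat
  assumes "qrank A = s"
    and "qindex A = k"
    and "qrank (mpow A k) = s1" and "s1 \<ge> 1"
    and "X = mpd_inverse A"
  shows "(\<forall>i j. X $ i $ j =
      (\<Sum>\<beta>\<in>ksets_at s i. cdet \<beta> i (repl_col (qadj A ** A) i (column j (V_tilde A)))) /\<^sub>R
      ((\<Sum>\<beta>\<in>ksets s. hdet \<beta> (qadj A ** A)) *
       (\<Sum>\<beta>\<in>ksets s1. hdet \<beta> (qadj (mpow A (2 * k + 1)) ** mpow A (2 * k + 1)))))
    \<and> (qhermitian A \<longrightarrow> (\<forall>i j.
      X $ i $ j =
        (\<Sum>\<beta>\<in>ksets_at s i. cdet \<beta> i (repl_col (mpow A 2) i (v_col A j))) /\<^sub>R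
        ((\<Sum>\<beta>\<in>ksets s. hdet \<beta> (mpow A 2)) * (\<Sum>\<beta>\<in>ksets s1. hdet \<beta> (mpow A (k + 1)))) \<and>
      X $ i $ j =
        (\<Sum>\<alpha>\<in>ksets_at s1 j. rdet \<alpha> j (repl_row (mpow A (k + 1)) j (u_row A i))) /\<^sub>R
        ((\<Sum>\<alpha>\<in>ksets s1. hdet \<alpha> (mpow A (k + 1))) * (\<Sum>\<alpha>\<in>ksets s. hdet \<alpha> (mpow A 2)))))"
proof -
  have s1: "s1 > 0" using assms(4) by simp
  have "s1 \<le> s" using qrank_mpow_qindex_le[of A] assms by simp
  then have s: "s > 0" using s1 by simp
  have dA: "minor_sum s (qadj A ** A) \<noteq> 0"
    using gram_minor_sum_nonzero[of A] assms(1) by simp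
  define T where "T = mpow A (2 * k + 1)"
  have "qrank T = s1" using qrank_mpow_qindex[of A] unfolding T_def assms(2,3) by simp
  then have dT: "minor_sum s1 (qadj T ** T) \<noteq> 0" using gram_minor_sum_nonzero[of T] by simp
  have solve: "x = y /\<^sub>R c" if "y = c *\<^sub>R x" "c \<noteq> 0" for x y :: quat and c
    using that by simp
  have general: "X $ i $ j =
      (\<Sum>\<beta>\<in>ksets_at s i. cdet \<beta> i (repl_col (qadj A ** A) i (column j (V_tilde A)))) /\<^sub>R
      ((\<Sum>\<beta>\<in>ksets s. hdet \<beta> (qadj A ** A)) * (\<Sum>\<beta>\<in>ksets s1. hdet \<beta> (qadj T ** T)))" for i j
    unfolding sum_hdet_hermitian[OF qhermitian_gram s] sum_hdet_hermitian[OF qhermitian_gram s1]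
    using cdet_representation[where A = A and i = i and j = j] dA dT
    unfolding assms(2,1) assms(3) T_def[symmetric] assms(5)[symmetric]
    by (intro solve) simp_all
  define G where "G = mpow A (k + 1)"
  have hermitian: "X $ i $ j =
        (\<Sum>\<beta>\<in>ksets_at s i. cdet \<beta> i (repl_col (mpow A 2) i (v_col A j))) /\<^sub>R
        ((\<Sum>\<beta>\<in>ksets s. hdet \<beta> (mpow A 2)) * (\<Sum>\<beta>\<in>ksets s1. hdet \<beta> G)) \<and>
      X $ i $ j =
        (\<Sum>\<alpha>\<in>ksets_at s1 j. rdet \<alpha> j (repl_row G j (u_row A i))) /\<^sub>R
        ((\<Sum>\<alpha>\<in>ksets s1. hdet \<alpha> G) * (\<Sum>\<alpha>\<in>ksets s. hdet \<alpha> (mpow A 2)))"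
    if H: "qhermitian A" for i j
  proof -
    have adj: "qadj A = A" using H by (simp add: qhermitian_def)
    have powH: "qhermitian (mpow A m)" for m by (simp only: qhermitian_def qadj_mpow adj)
    have GH: "qhermitian G" unfolding G_def by (rule powH)
    have dA2: "minor_sum s (mpow A 2) \<noteq> 0" using dA by (simp add: adj numeral_2_eq_2)
    have "qrank G = s1" using qrank_qindex[of A] unfolding G_def assms(2,3) .
    then have dG: "minor_sum s1 G \<noteq> 0" using minor_sum_qrank_nonzero[OF GH] by simp
    \<comment> \<open>Both numerators are entries of this triple product: \<open>v_col\<close> takes
      up its last two factors, \<open>u_row\<close> its first two.\<close>
    have rep: "coadj s (mpow A 2) ** mpow A (k + 2) ** coadj s1 G = (minor_sum s (mpow A 2) * minor_sum s1 G) *\<^sub>R X"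
      using hermitian_representation[OF H] unfolding assms(2,1) assms(3,5) G_def .
    have "v_col A j = column j (mpow A (k + 2) ** coadj s1 G)"
      unfolding v_col_def Let_def assms(2) assms(3) G_def[symmetric] coadj_mult_row[OF GH] qadj_coadj[OF GH]
      by (simp add: vec_eq_iff column_def)
    then have "(\<Sum>\<beta>\<in>ksets_at s i. cdet \<beta> i (repl_col (mpow A 2) i (v_col A j))) =
      (minor_sum s (mpow A 2) * minor_sum s1 G) *\<^sub>R X $ i $ j"
      by (simp only: coadj_mult_column[OF powH] matrix_mul_assoc rep) simp
    moreover have "u_row A i = row i (coadj s (mpow A 2) ** mpow A (k + 2))"
      unfolding u_row_def Let_def assms(2) assms(1) coadj_mult_column[OF powH]
      by (simp add: vec_eq_iff row_def)
    then have "(\<Sum>\<alpha>\<in>ksets_at s1 j. rdet \<alpha> j (repl_row G j (u_row A i))) =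
      (minor_sum s (mpow A 2) * minor_sum s1 G) *\<^sub>R X $ i $ j"
      by (simp only: coadj_mult_row[OF GH] qadj_coadj[OF GH] rep) simp
    ultimately show ?thesis
      using dA2 dG unfolding sum_hdet_hermitian[OF powH s] sum_hdet_hermitian[OF GH s1]
      by (intro conjI solve) (simp_all add: mult.commute)
  qed
  show ?thesis using general hermitian unfolding T_def G_def by blast
qed

end
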